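(* Fix a finite set $S$ of first-order clauses and a depth limit $d$. If a closed connection tableau for $S$ exists within depth limit $d$, then the constraint-learning search procedure described in the context, run on $S$ with depth limit $d$, finds a closed tableau (i.e. it terminates with a closed tableau rather than by learning the empty constraint).
   Context: Clausal connection tableau calculus (free-variable, with a single global substitution $\sigma$, input a finite set $S$ of first-order clauses without equality). Inference rules: (Start) an empty tableau is extended by attaching the literals $L_1,\dots,L_n$ of a clause $C=L_1\vee\dots\vee L_n\in S$ (variables renamed apart from the tableau) as children of the root. (Reduction) an open branch whose leaf literal $L_1$ can be made complementary to a literal $L$ on its path (i.e. $\sigma(\lnot L)=\sigma(L_1)$ after extending $\sigma$ by a unifier) is closed, extending $\sigma$ accordingly. (Extension) below the leaf literal $L$ of an open branch, the literals $L_1,\dots,L_n$ of a renamed copy of a clause $C\in S$ are attached as children, where for the connected literal $L_i$ one requires $\sigma(\lnot L)=\sigma(L_i)$ after extending $\sigma$; the branch through $L_i$ is then closed. A tableau is closed when all branches are closed. Only tableaux whose branches do not exceed the depth limit are considered. Positions: the root is the empty position, and $p.i$ is the $i$-th child of position $p$; variables are named after the position below which their clause is attached, so names are stable under backtracking. Constraint language: an atom is one of $\mathcal{S}_C$ (the tableau was started with clause $C$), $\mathcal{R}^q_p$ (a reduction from position $p$ to an ancestor position $q$), or $\mathcal{E}^C_{p/i}$ (position $p$ was extended by connecting to the $i$-th literal of clause $C$). A constraint is a finite set of atoms. Each applied inference corresponds to an atom; a constraint is violated by a trail if all of its atoms are on the trail. Reasons. Let $T$ be a tableau built by a set of inferences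 $I$, $B$ an open branch, and $I'\subseteq I$ the inferences needed to produce $B$ (the start step and the extensions along the path to $B$), giving sub-tableau $T'$. If an inference $j$ applicable to $B$ in $T'$ is not applicable in $T$, a reason for its failure is a minimal $E\subseteq I\setminus I'$ such that applying $E$ additionally to $T'$ prevents applying $j$ at $B$. If no inference $j$ among those possible at $B$ in $T'$ can be applied in $T$, a reason that $T$ is stuck is $I'\cup\bigcup_j R_j$, where $R_j$ is a failure reason for $j$ as just defined if the calculus prevents $j$, and $R_j=R'\setminus\{j\}$ if $j$ is prevented because it would complete a previously learned constraint $R'$. Search procedure. Maintain the current tableau $T$ (with $\sigma$), a set of learned constraints (initially empty), and a trail (stack) of atoms of the inferences currently applied (initially empty). Repeat: select an open branch $B$ (for the empty tableau, choose a start clause); initialise a candidate constraint learn to $I'$ for $B$; for each possible inference $j$ at $B$: if $j$ cannot be applied in the calculus, add a failure reason for $j$ to learn; else if some learned constraint $C\cup\{j\}$ is violated by $j$ together with the trail, add $C$ to learn; otherwise apply $j$, push its atom onto the trail, and proceed to the next iteration. If no inference succeeded, pop atoms from the trail (undoing the corresponding inferences) until learn is no longer violated, and record learn as a learned constraint. Stop when $T$ is closed or when the learned constraint is empty. Learned constraints are never forgotten within one depth limit. *)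

theory Defs
  imports "HOL-Library.Sublist"
begin

section \<open>First-order clauses and unification\<close>

datatype ('f, 'v) tm = Var 'v | Fun 'f "('f, 'v) tm list"

datatype ('f, 'p, 'v) literal = Pos 'p "('f, 'v) tm list" | Neg 'p "('f, 'v) tm list"

text \<open>A clause is the list of its literals, because inferences refer to the i-th literal.
  Literal and child indices start at 0.\<close>

type_synonym ('f, 'p, 'v) clause = "('f, 'p, 'v) literal list"

primrec compl :: "('f, 'p, 'v) literal \<Rightarrow> ('f, 'p, 'v) literal" where
  "compl (Pos P ts) = Neg P ts"
| "compl (Neg P ts) = Pos P ts"

primrec subst_tm :: "('v \<Rightarrow> ('f, 'w) tm) \<Rightarrow> ('f, 'v) tm \<Rightarrow> ('f, 'w) tm" where
  "subst_tm \<sigma> (Var x) = \<sigma> x"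
| "subst_tm \<sigma> (Fun f ts) = Fun f (map (subst_tm \<sigma>) ts)"

primrec subst_lit :: "('v \<Rightarrow> ('f, 'w) tm) \<Rightarrow> ('f, 'p, 'v) literal \<Rightarrow> ('f, 'p, 'w) literal" where
  "subst_lit \<sigma> (Pos P ts) = Pos P (map (subst_tm \<sigma>) ts)"
| "subst_lit \<sigma> (Neg P ts) = Neg P (map (subst_tm \<sigma>) ts)"

text \<open>\<open>subst_comp \<mu> \<sigma>\<close> applies \<open>\<sigma>\<close> first.\<close>

definition subst_comp ::
  "('v \<Rightarrow> ('f, 'w) tm) \<Rightarrow> ('u \<Rightarrow> ('f, 'v) tm) \<Rightarrow> 'u \<Rightarrow> ('f, 'w) tm" where
  "subst_comp \<mu> \<sigma> = (\<lambda>x. subst_tm \<mu> (\<sigma> x))"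

definition is_mgu ::
  "('v \<Rightarrow> ('f, 'v) tm) \<Rightarrow> ('f, 'p, 'v) literal \<Rightarrow> ('f, 'p, 'v) literal \<Rightarrow> bool" where
  "is_mgu \<mu> K L \<longleftrightarrow> subst_lit \<mu> K = subst_lit \<mu> L \<and>
     (\<forall>\<tau> :: 'v \<Rightarrow> ('f, 'v) tm. subst_lit \<tau> K = subst_lit \<tau> L \<longrightarrow> (\<exists>\<gamma>. \<tau> = subst_comp \<gamma> \<mu>))"


section \<open>Connection tableaux\<close>

type_synonym pos = "nat list"

text \<open>The variable \<open>x\<close> of a clause attached below position \<open>p\<close> becomes \<open>(p, x)\<close>.\<close>

definition rename :: "pos \<Rightarrow> ('f, 'p, 'v) literal \<Rightarrow> ('f, 'p, pos \<times> 'v) literal" where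
  "rename p = subst_lit (\<lambda>x. Var (p, x))"

text \<open>The root is a node without a literal. \<open>expanded\<close> holds the positions below which a clause
  has been attached; without it the empty tableau could not be told apart from one started with
  the empty clause. A branch is identified with the position of its leaf.\<close>

record ('f, 'p, 'v) tableau =
  label :: "pos \<rightharpoonup> ('f, 'p, pos \<times> 'v) literal"
  expanded :: "pos set"
  closed_leaves :: "pos set"
  global_subst :: "pos \<times> 'v \<Rightarrow> ('f, pos \<times> 'v) tm"

definition empty_tableau :: "('f, 'p, 'v) tableau" where
  "empty_tableau = \<lparr>label = Map.empty, expanded = {}, closed_leaves = {}, global_subst = Var\<rparr>"

definition nodes :: "('f, 'p, 'v) tableau \<Rightarrow> pos set" where
  "nodes T = insert [] (dom (label T))"

definition open_branch :: "('f, 'p, 'v) tableau \<Rightarrow> pos \<Rightarrow> bool" where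
  "open_branch T p \<longleftrightarrow> p \<in> nodes T \<and> p \<notin> expanded T \<and> p \<notin> closed_leaves T"

definition is_closed :: "('f, 'p, 'v) tableau \<Rightarrow> bool" where
  "is_closed T \<longleftrightarrow> (\<nexists>p. open_branch T p)"

definition within_depth :: "nat \<Rightarrow> ('f, 'p, 'v) tableau \<Rightarrow> bool" where
  "within_depth d T \<longleftrightarrow> (\<forall>p \<in> nodes T. length p \<le> d)"

definition attach ::
  "pos \<Rightarrow> ('f, 'p, 'v) clause \<Rightarrow> ('f, 'p, 'v) tableau \<Rightarrow> ('f, 'p, 'v) tableau" where
  "attach p C T = T\<lparr>
     label := label T ++ map_of (map (\<lambda>i. (p @ [i], rename p (C ! i))) [0..<length C]),
     expanded := insert p (expanded T)\<rparr>"

definition close_leaf :: "pos \<Rightarrow> ('f, 'p, 'v) tableau \<Rightarrow> ('f, 'p, 'v) tableau" where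
  "close_leaf p T = T\<lparr>closed_leaves := insert p (closed_leaves T)\<rparr>"

definition extend_subst ::
  "(pos \<times> 'v \<Rightarrow> ('f, pos \<times> 'v) tm) \<Rightarrow> ('f, 'p, 'v) tableau \<Rightarrow> ('f, 'p, 'v) tableau" where
  "extend_subst \<mu> T = T\<lparr>global_subst := subst_comp \<mu> (global_subst T)\<rparr>"

text \<open>\<open>Start C\<close>, \<open>Reduction q p\<close> and \<open>Extension C p i\<close> stand for \<open>\<S>\<^sub>C\<close>, for the reduction from
  \<open>p\<close> to its ancestor \<open>q\<close>, and for the extension of \<open>p\<close> by connecting to the \<open>i\<close>-th literal
  of \<open>C\<close>.\<close>

datatype ('f, 'p, 'v) atom =
    Start "('f, 'p, 'v) clause"
  | Reduction pos pos
  | Extension "('f, 'p, 'v) clause" pos nat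

type_synonym ('f, 'p, 'v) constraint = "('f, 'p, 'v) atom set"

text \<open>The position of the open branch an inference acts on.\<close>

primrec acts_at :: "('f, 'p, 'v) atom \<Rightarrow> pos" where
  "acts_at (Start C) = []"
| "acts_at (Reduction q p) = p"
| "acts_at (Extension C p i) = p"

inductive infer ::
  "('f, 'p, 'v) clause set \<Rightarrow> nat \<Rightarrow> ('f, 'p, 'v) atom \<Rightarrow>
   ('f, 'p, 'v) tableau \<Rightarrow> ('f, 'p, 'v) tableau \<Rightarrow> bool"
  for S :: "('f, 'p, 'v) clause set" and d :: nat where
  start:
    "\<lbrakk>T = empty_tableau; C \<in> S; T' = attach [] C T; within_depth d T'\<rbrakk>
     \<Longrightarrow> infer S d (Start C) T T'"
| reduction:
    "\<lbrakk>open_branch T p; label T p = Some L1; strict_prefix q p; label T q = Some L;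
      is_mgu \<mu> (subst_lit (global_subst T) (compl L)) (subst_lit (global_subst T) L1);
      T' = extend_subst \<mu> (close_leaf p T); within_depth d T'\<rbrakk>
     \<Longrightarrow> infer S d (Reduction q p) T T'"
| extension:
    "\<lbrakk>open_branch T p; label T p = Some L; C \<in> S; i < length C;
      is_mgu \<mu> (subst_lit (global_subst T) (compl L))
               (subst_lit (global_subst T) (rename p (C ! i)));
      T' = extend_subst \<mu> (close_leaf (p @ [i]) (attach p C T)); within_depth d T'\<rbrakk>
     \<Longrightarrow> infer S d (Extension C p i) T T'"

definition applicable ::
  "('f, 'p, 'v) clause set \<Rightarrow> nat \<Rightarrow> ('f, 'p, 'v) atom \<Rightarrow> ('f, 'p, 'v) tableau \<Rightarrow> bool" where
  "applicable S d j T \<longleftrightarrow> (\<exists>T'. infer S d j T T')"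

primrec infers ::
  "('f, 'p, 'v) clause set \<Rightarrow> nat \<Rightarrow> ('f, 'p, 'v) atom list \<Rightarrow>
   ('f, 'p, 'v) tableau \<Rightarrow> ('f, 'p, 'v) tableau \<Rightarrow> bool" where
  "infers S d [] T T' \<longleftrightarrow> T' = T"
| "infers S d (j # js) T T' \<longleftrightarrow> (\<exists>U. infer S d j T U \<and> infers S d js U T')"

text \<open>\<open>T'\<close> results from applying all the inferences in \<open>E\<close> to \<open>T\<close>, in some order.\<close>

definition apply_all ::
  "('f, 'p, 'v) clause set \<Rightarrow> nat \<Rightarrow> ('f, 'p, 'v) atom set \<Rightarrow>
   ('f, 'p, 'v) tableau \<Rightarrow> ('f, 'p, 'v) tableau \<Rightarrow> bool" where
  "apply_all S d E T T' \<longleftrightarrow> (\<exists>js. distinct js \<and> set js = E \<and> infers S d js T T')"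

definition closed_tableau :: "('f, 'p, 'v) clause set \<Rightarrow> nat \<Rightarrow> ('f, 'p, 'v) tableau \<Rightarrow> bool" where
  "closed_tableau S d T \<longleftrightarrow> (\<exists>js. infers S d js empty_tableau T) \<and> is_closed T"


section \<open>Reasons\<close>

definition path_inferences :: "('f, 'p, 'v) atom set \<Rightarrow> pos \<Rightarrow> ('f, 'p, 'v) atom set" where
  "path_inferences I p =
     {j \<in> I. (\<exists>C. j = Start C \<and> p \<noteq> []) \<or> (\<exists>C q i. j = Extension C q i \<and> strict_prefix q p)}"

definition possible_inferences ::
  "('f, 'p, 'v) clause set \<Rightarrow> nat \<Rightarrow> ('f, 'p, 'v) atom set \<Rightarrow> pos \<Rightarrow> ('f, 'p, 'v) atom set" where
  "possible_inferences S d I p =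
     {j. acts_at j = p \<and>
         (\<exists>T'. apply_all S d (path_inferences I p) empty_tableau T' \<and> applicable S d j T')}"

definition prevents ::
  "('f, 'p, 'v) clause set \<Rightarrow> nat \<Rightarrow> ('f, 'p, 'v) atom set \<Rightarrow> pos \<Rightarrow>
   ('f, 'p, 'v) atom \<Rightarrow> ('f, 'p, 'v) atom set \<Rightarrow> bool" where
  "prevents S d I p j E \<longleftrightarrow>
     (\<exists>T' T''. apply_all S d (path_inferences I p) empty_tableau T' \<and>
               apply_all S d E T' T'' \<and> \<not> applicable S d j T'')"

definition failure_reason ::
  "('f, 'p, 'v) clause set \<Rightarrow> nat \<Rightarrow> ('f, 'p, 'v) atom set \<Rightarrow> pos \<Rightarrow>
   ('f, 'p, 'v) atom \<Rightarrow> ('f, 'p, 'v) atom set \<Rightarrow> bool" where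
  "failure_reason S d I p j E \<longleftrightarrow>
     E \<subseteq> I - path_inferences I p \<and> prevents S d I p j E \<and>
     (\<forall>E'. E' \<subset> E \<longrightarrow> \<not> prevents S d I p j E')"


section \<open>The search procedure\<close>

definition violated :: "('f, 'p, 'v) constraint \<Rightarrow> ('f, 'p, 'v) atom set \<Rightarrow> bool" where
  "violated c I \<longleftrightarrow> c \<subseteq> I"

text \<open>The stack has its top at the head of the list. Each atom is stored with the tableau to which
  its inference was applied, which is what undoing the inference restores.\<close>

type_synonym ('f, 'p, 'v) trail = "(('f, 'p, 'v) atom \<times> ('f, 'p, 'v) tableau) list"

definition trail_atoms :: "('f, 'p, 'v) trail \<Rightarrow> ('f, 'p, 'v) atom set" where
  "trail_atoms tr = fst ` set tr"

record ('f, 'p, 'v) state =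
  current :: "('f, 'p, 'v) tableau"
  trail :: "('f, 'p, 'v) trail"
  learned :: "('f, 'p, 'v) constraint set"

definition initial_state :: "('f, 'p, 'v) state" where
  "initial_state = \<lparr>current = empty_tableau, trail = [], learned = {}\<rparr>"

text \<open>A learned constraint violated by \<open>j\<close> together with the trail \<open>I\<close>.\<close>

definition blocks ::
  "('f, 'p, 'v) atom set \<Rightarrow> ('f, 'p, 'v) atom \<Rightarrow> ('f, 'p, 'v) constraint \<Rightarrow> bool" where
  "blocks I j c \<longleftrightarrow> j \<in> c \<and> violated c (insert j I)"

datatype ('f, 'p, 'v) outcome =
    Applied "('f, 'p, 'v) atom" "('f, 'p, 'v) tableau"
  | Stuck "('f, 'p, 'v) constraint"

text \<open>\<open>try_each S d s p js c r\<close>: the loop over the remaining possible inferences \<open>js\<close> at branch \<open>p\<close>,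
  entered with candidate constraint \<open>c\<close>, ends with outcome \<open>r\<close>.\<close>

inductive try_each ::
  "('f, 'p, 'v) clause set \<Rightarrow> nat \<Rightarrow> ('f, 'p, 'v) state \<Rightarrow> pos \<Rightarrow>
   ('f, 'p, 'v) atom list \<Rightarrow> ('f, 'p, 'v) constraint \<Rightarrow> ('f, 'p, 'v) outcome \<Rightarrow> bool"
  for S :: "('f, 'p, 'v) clause set" and d :: nat and s :: "('f, 'p, 'v) state" and p :: pos where
  exhausted:
    "try_each S d s p [] c (Stuck c)"
| fails:
    "\<lbrakk>\<not> applicable S d j (current s); failure_reason S d (trail_atoms (trail s)) p j E;
      try_each S d s p js (c \<union> E) r\<rbrakk>
     \<Longrightarrow> try_each S d s p (j # js) c r"
| blocked:
    "\<lbrakk>applicable S d j (current s); c' \<in> learned s; blocks (trail_atoms (trail s)) j c';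
      try_each S d s p js (c \<union> (c' - {j})) r\<rbrakk>
     \<Longrightarrow> try_each S d s p (j # js) c r"
| succeeds:
    "\<lbrakk>infer S d j (current s) T'; \<forall>c' \<in> learned s. \<not> blocks (trail_atoms (trail s)) j c'\<rbrakk>
     \<Longrightarrow> try_each S d s p (j # js) c (Applied j T')"

fun backtrack ::
  "('f, 'p, 'v) constraint \<Rightarrow> ('f, 'p, 'v) tableau \<Rightarrow> ('f, 'p, 'v) trail \<Rightarrow>
   ('f, 'p, 'v) tableau \<times> ('f, 'p, 'v) trail" where
  "backtrack c T [] = (T, [])"
| "backtrack c T ((j, T0) # tr) =
     (if violated c (trail_atoms ((j, T0) # tr)) then backtrack c T0 tr else (T, (j, T0) # tr))"

definition stopped :: "('f, 'p, 'v) state \<Rightarrow> bool" where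
  "stopped s \<longleftrightarrow> is_closed (current s) \<or> {} \<in> learned s"

text \<open>One iteration. The selected branch \<open>p\<close>, the order \<open>js\<close> in which the possible inferences are
  tried, the failure reasons and the blocking constraints are left open.\<close>

inductive iteration ::
  "('f, 'p, 'v) clause set \<Rightarrow> nat \<Rightarrow> ('f, 'p, 'v) state \<Rightarrow> ('f, 'p, 'v) state \<Rightarrow> bool"
  for S :: "('f, 'p, 'v) clause set" and d :: nat where
  apply_inference:
    "\<lbrakk>\<not> stopped s; open_branch (current s) p; I = trail_atoms (trail s);
      distinct js; set js = possible_inferences S d I p;
      try_each S d s p js (path_inferences I p) (Applied j T')\<rbrakk>
     \<Longrightarrow> iteration S d s (s\<lparr>current := T', trail := (j, current s) # trail s\<rparr>)"
| learn_constraint: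
    "\<lbrakk>\<not> stopped s; open_branch (current s) p; I = trail_atoms (trail s);
      distinct js; set js = possible_inferences S d I p;
      try_each S d s p js (path_inferences I p) (Stuck c);
      backtrack c (current s) (trail s) = (T', tr')\<rbrakk>
     \<Longrightarrow> iteration S d s \<lparr>current = T', trail = tr', learned = insert c (learned s)\<rparr>"

end

theory Submission
  imports Defs
begin

text \<open>
  The connections of a set of inferences are solvable independently of the order in which they are
  solved. Hence, for the atom set \<open>J\<close> of a closed tableau, every inference of \<open>J\<close> is applicable to
  every tableau built from a subset of \<open>J\<close> as soon as its branch exists there.
  No constraint \<open>c \<subseteq> J\<close> is ever learned: if \<open>c\<close> is learned at branch \<open>p\<close>, then \<open>J\<close> contains the
  path to \<open>p\<close> and therefore some inference \<open>j\<close> at \<open>p\<close>. Either \<open>c\<close> contains a failure reason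
  for \<open>j\<close>, which then consists of inferences of \<open>J\<close> that prevent \<open>j\<close>, or \<open>c\<close> contains
  \<open>c' - {j}\<close> for an earlier learned \<open>c'\<close>, and then already \<open>c' \<subseteq> J\<close>. In particular the empty
  constraint is not learned. The search terminates because within the depth limit there are finitely
  many atoms and every learned constraint is new.
\<close>

section \<open>Most general unifiers\<close>

lemma subst_tm_comp: "subst_tm \<mu> (subst_tm \<sigma> t) = subst_tm (subst_comp \<mu> \<sigma>) t"
  by (induction t) (auto simp: subst_comp_def)

lemma subst_lit_comp: "subst_lit \<mu> (subst_lit \<sigma> L) = subst_lit (subst_comp \<mu> \<sigma>) L"
  by (cases L) (auto simp: subst_tm_comp)

lemma subst_comp_assoc: "subst_comp \<gamma> (subst_comp \<mu> \<sigma>) = subst_comp (subst_comp \<gamma> \<mu>) \<sigma>"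
  by (rule ext) (simp add: subst_comp_def subst_tm_comp[unfolded subst_comp_def])

lemma subst_tm_Var: "subst_tm Var t = t"
  by (induction t) (auto simp: map_idI)

lemma subst_comp_Var_right: "subst_comp \<gamma> Var = \<gamma>"
  by (simp add: subst_comp_def)

lemma subst_comp_Var_left: "subst_comp Var \<sigma> = \<sigma>"
  by (simp add: subst_comp_def subst_tm_Var)

lemma subst_tm_cong: "(\<And>x. x \<in> set2_tm t \<Longrightarrow> \<sigma> x = \<tau> x) \<Longrightarrow> subst_tm \<sigma> t = subst_tm \<tau> t"
  by (induction t) auto

lemma set2_subst_tm: "set2_tm (subst_tm \<sigma> t) = (\<Union>x \<in> set2_tm t. set2_tm (\<sigma> x))"
  by (induction t) auto

lemma finite_set2_tm: "finite (set2_tm t)"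
  by (induction t) auto

lemma size_subst_var_le: "x \<in> set2_tm t \<Longrightarrow> size (\<tau> x) \<le> size (subst_tm \<tau> t)"
proof (induction t)
  case (Fun f ts)
  then obtain u where u: "u \<in> set ts" "x \<in> set2_tm u" by auto
  with Fun.IH have "size (\<tau> x) \<le> size (subst_tm \<tau> u)" by blast
  also have "\<dots> \<le> size_list size (map (subst_tm \<tau>) ts)"
    using u(1) by (intro size_list_estimation') auto
  finally show ?case by simp
qed auto

text \<open>If \<open>x\<close> occurs in \<open>t\<close> below a function symbol, then
  \<open>\<tau> x\<close> is a proper subterm of the instance of \<open>t\<close>, hence strictly
  smaller in size.\<close>

lemma occurs_not_unifiable:
  assumes "x \<in> set2_tm t" "t \<noteq> Var x"
  shows "\<tau> x \<noteq> subst_tm \<tau> t"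
proof (cases t)
  case (Fun f ts)
  with assms obtain u where u: "u \<in> set ts" "x \<in> set2_tm u" by auto
  have "size (\<tau> x) \<le> size (subst_tm \<tau> u)" using u(2) by (rule size_subst_var_le)
  also have "\<dots> \<le> size_list size (map (subst_tm \<tau>) ts)"
    using u(1) by (intro size_list_estimation') auto
  finally have "size (\<tau> x) < size (subst_tm \<tau> t)" using Fun by simp
  then show ?thesis by auto
qed (use assms in auto)

section \<open>Existence of most general unifiers for lists of equations\<close>

definition unifies ::
  "('v \<Rightarrow> ('f, 'w) tm) \<Rightarrow> (('f, 'v) tm \<times> ('f, 'v) tm) list \<Rightarrow> bool" where
  "unifies \<tau> es \<longleftrightarrow> (\<forall>(s, t) \<in> set es. subst_tm \<tau> s = subst_tm \<tau> t)"

definition most_general ::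
  "('v \<Rightarrow> ('f, 'v) tm) \<Rightarrow> (('f, 'v) tm \<times> ('f, 'v) tm) list \<Rightarrow> bool" where
  "most_general \<mu> es \<longleftrightarrow> unifies \<mu> es \<and>
     (\<forall>\<tau> :: 'v \<Rightarrow> ('f, 'v) tm. unifies \<tau> es \<longrightarrow> (\<exists>\<gamma>. \<tau> = subst_comp \<gamma> \<mu>))"

definition eqs_vars :: "(('f, 'v) tm \<times> ('f, 'v) tm) list \<Rightarrow> 'v set" where
  "eqs_vars es = (\<Union>(s, t) \<in> set es. set2_tm s \<union> set2_tm t)"

definition subst_eqs ::
  "('v \<Rightarrow> ('f, 'w) tm) \<Rightarrow> (('f, 'v) tm \<times> ('f, 'v) tm) list \<Rightarrow> (('f, 'w) tm \<times> ('f, 'w) tm) list"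
  where "subst_eqs \<sigma> = map (\<lambda>(s, t). (subst_tm \<sigma> s, subst_tm \<sigma> t))"

lemma finite_eqs_vars: "finite (eqs_vars es)"
  by (auto simp: eqs_vars_def finite_set2_tm)

lemma unifies_Cons: "unifies \<tau> ((s, t) # es) \<longleftrightarrow> subst_tm \<tau> s = subst_tm \<tau> t \<and> unifies \<tau> es"
  by (auto simp: unifies_def)

lemma unifies_subst_eqs: "unifies \<tau> (subst_eqs \<sigma> es) \<longleftrightarrow> unifies (subst_comp \<tau> \<sigma>) es"
  by (force simp: unifies_def subst_eqs_def subst_tm_comp)

text \<open>This is why eliminating a variable loses no unifier: a substitution that already equates
  \<open>x\<close> with \<open>t\<close> factors through the binding, with itself as the
  factor.\<close>

lemma unifier_absorbs_binding:
  assumes "\<tau> x = subst_tm \<tau> t"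
  shows "subst_comp \<tau> (Var(x := t)) = \<tau>"
  using assms by (auto simp: subst_comp_def)

text \<open>Since \<open>x\<close> does not occur in \<open>t\<close>, the binding leaves
  \<open>t\<close> unchanged, so it solves the equation for \<open>x\<close>. A unifier of the whole
  list absorbs the binding, so it solves the substituted rest and factors through
  \<open>\<mu>\<close>.\<close>

lemma most_general_eliminate:
  fixes \<mu> :: "'v \<Rightarrow> ('f, 'v) tm"
  assumes x: "x \<notin> set2_tm t" and mg: "most_general \<mu> (subst_eqs (Var(x := t)) es)"
  shows "most_general (subst_comp \<mu> (Var(x := t))) ((Var x, t) # es)"
proof -
  let ?b = "Var(x := t)"
  have t: "subst_tm ?b t = t"
    using subst_tm_cong[of t ?b Var] x by (metis fun_upd_other subst_tm_Var)
  have "unifies (subst_comp \<mu> ?b) es"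
    using mg by (simp add: most_general_def unifies_subst_eqs)
  moreover have "subst_tm (subst_comp \<mu> ?b) (Var x) = subst_tm (subst_comp \<mu> ?b) t"
    unfolding subst_tm_comp[symmetric] by (simp add: t)
  moreover have "\<exists>\<gamma>. \<tau> = subst_comp \<gamma> (subst_comp \<mu> ?b)"
    if "unifies \<tau> ((Var x, t) # es)" for \<tau> :: "'v \<Rightarrow> ('f, 'v) tm"
  proof -
    have \<tau>: "subst_comp \<tau> ?b = \<tau>"
      using that by (intro unifier_absorbs_binding) (simp add: unifies_Cons)
    then have "unifies \<tau> (subst_eqs ?b es)"
      using that by (simp add: unifies_subst_eqs unifies_Cons)
    then obtain \<gamma> where "\<tau> = subst_comp \<gamma> \<mu>"
      using mg by (auto simp: most_general_def)
    then show ?thesis using \<tau> subst_comp_assoc by metis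
  qed
  ultimately show ?thesis by (simp add: most_general_def unifies_Cons)
qed

lemma card_eqs_vars_eliminate:
  assumes "x \<notin> set2_tm t" "set2_tm t \<subseteq> V" "eqs_vars es \<subseteq> V" "x \<in> V" "finite V"
  shows "card (eqs_vars (subst_eqs (Var(x := t)) es)) < card V"
proof -
  have "set2_tm (subst_tm (Var(x := t)) s) \<subseteq> V - {x}" if "set2_tm s \<subseteq> V" for s :: "('b, 'a) tm"
    using that assms(1,2) by (auto simp: set2_subst_tm split: if_splits)
  then have "eqs_vars (subst_eqs (Var(x := t)) es) \<subseteq> V - {x}"
    using assms(3) unfolding eqs_vars_def subst_eqs_def
    by (simp add: UN_subset_iff split_beta)
  then show ?thesis using assms(4,5) by (intro psubset_card_mono) auto
qed

text \<open>Unification by elimination and decomposition, with a lexicographic measure. Eliminating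
  a variable lowers the number of variables; decomposition adds no variables and removes the head
  symbol from the left sides; the length accounts for deleting a trivial equation between equal
  variables.\<close>

lemma most_general_exists:
  fixes \<tau> :: "'v \<Rightarrow> ('f, 'v) tm"
  assumes "unifies \<tau> es"
  shows "\<exists>\<mu>. most_general \<mu> es"
  using assms
proof (induction es rule: wf_induct_rule[OF wf_measures[of
      "[\<lambda>es. card (eqs_vars es), \<lambda>es. sum_list (map (size \<circ> fst) es), length]"]])
  case (1 es)
  \<comment> \<open>Both orientations of an equation with a variable side are treated at once. The
    answer is always stated with the variable on the left, and the case of a variable on the right
    swaps the sides back.\<close>
  have var: "\<exists>\<mu>. most_general \<mu> ((Var x, t) # es')"
    if es: "es = (Var x, t) # es' \<or> es = (t, Var x) # es'" for x t es'
  proof (cases "t = Var x")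
    case True
    have "eqs_vars es' \<subseteq> eqs_vars es" using es by (auto simp: eqs_vars_def)
    then have "card (eqs_vars es') \<le> card (eqs_vars es)"
      by (rule card_mono[OF finite_eqs_vars])
    moreover have "unifies \<tau> es'" using 1(2) es by (auto simp: unifies_Cons)
    ultimately obtain \<mu> where "most_general \<mu> es'"
      using 1(1)[of es'] es True by fastforce
    then show ?thesis using True by (auto simp: most_general_def unifies_Cons)
  next
    case False
    have \<tau>: "\<tau> x = subst_tm \<tau> t" "unifies \<tau> es'" using 1(2) es by (auto simp: unifies_Cons)
    then have x: "x \<notin> set2_tm t" using occurs_not_unifiable False by metis
    have "card (eqs_vars (subst_eqs (Var(x := t)) es')) < card (eqs_vars es)"
      using es x by (intro card_eqs_vars_eliminate finite_eqs_vars) (auto simp: eqs_vars_def)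
    moreover have "unifies \<tau> (subst_eqs (Var(x := t)) es')"
      using \<tau> by (simp add: unifies_subst_eqs unifier_absorbs_binding)
    ultimately obtain \<mu> where "most_general \<mu> (subst_eqs (Var(x := t)) es')"
      using 1(1) by fastforce
    then show ?thesis using most_general_eliminate[OF x] by blast
  qed
  show ?case
  proof (cases es)
    case Nil
    then have "most_general Var es"
      by (simp add: most_general_def unifies_def subst_comp_Var_right)
    then show ?thesis by blast
  next
    case (Cons e es')
    obtain s t where e: "e = (s, t)" by force
    show ?thesis
    proof (cases s)
      case (Var x)
      then show ?thesis using var Cons e by blast
    next
      case s: (Fun f ss)
      show ?thesis
      proof (cases t)
        case (Var x)
        then obtain \<mu> where "most_general \<mu> ((Var x, s) # es')" using var Cons e by blast
        then show ?thesis
          using Cons e Var by (auto simp: most_general_def unifies_Cons eq_commute)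
      next
        case t: (Fun g ts)
        have "map (subst_tm \<tau>) ss = map (subst_tm \<tau>) ts" and fg: "f = g"
          using 1(2) Cons e s t by (auto simp: unifies_Cons)
        then have len: "length ss = length ts" by (metis length_map)
        have iff: "unifies \<theta> (zip ss ts @ es') \<longleftrightarrow> unifies \<theta> es" for \<theta> :: "'v \<Rightarrow> ('f, 'v) tm"
        proof -
          have "map (subst_tm \<theta>) ss = map (subst_tm \<theta>) ts \<longleftrightarrow> unifies \<theta> (zip ss ts)"
            using len by (auto simp: unifies_def list_eq_iff_nth_eq in_set_zip)
          then show ?thesis using Cons e s t fg by (auto simp: unifies_def)
        qed
        have "eqs_vars (zip ss ts @ es') \<subseteq> eqs_vars es"
          using Cons e s t by (fastforce simp: eqs_vars_def dest: set_zip_leftD set_zip_rightD)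
        then have "card (eqs_vars (zip ss ts @ es')) \<le> card (eqs_vars es)"
          by (rule card_mono[OF finite_eqs_vars])
        moreover have "sum_list (map (size \<circ> fst) (zip ss ts @ es')) < sum_list (map (size \<circ> fst) es)"
          using Cons e s len
          by (simp add: size_list_conv_sum_list map_map[symmetric] del: map_map)
        ultimately obtain \<mu> where "most_general \<mu> (zip ss ts @ es')"
          using 1(1)[of "zip ss ts @ es'"] 1(2) iff by fastforce
        then show ?thesis by (auto simp: most_general_def iff)
      qed
    qed
  qed
qed

text \<open>Two literals with a common instance have the same sign and predicate, so only their
  argument lists have to be unified; the given unifier also shows that these lists have equal
  length.\<close>

lemma is_mgu_exists:
  fixes \<tau> :: "'v \<Rightarrow> ('f, 'v) tm"
  assumes "subst_lit \<tau> K = subst_lit \<tau> L"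
  shows "\<exists>\<mu>. is_mgu \<mu> K L"
proof -
  obtain ss ts where st: "\<And>\<theta> :: 'v \<Rightarrow> ('f, 'v) tm.
      subst_lit \<theta> K = subst_lit \<theta> L \<longleftrightarrow> map (subst_tm \<theta>) ss = map (subst_tm \<theta>) ts"
    using assms by (cases K; cases L) auto
  then have len: "length ss = length ts" using assms by (metis length_map)
  then have "subst_lit \<theta> K = subst_lit \<theta> L \<longleftrightarrow> unifies \<theta> (zip ss ts)"
    for \<theta> :: "'v \<Rightarrow> ('f, 'v) tm"
    by (auto simp: st unifies_def list_eq_iff_nth_eq in_set_zip)
  then show ?thesis
    using most_general_exists[of \<tau> "zip ss ts"] assms by (simp add: is_mgu_def most_general_def)
qed

section \<open>Tableaux and atom sets\<close>

definition attached :: "('f, 'p, 'v) atom set \<Rightarrow> pos \<Rightarrow> ('f, 'p, 'v) clause \<Rightarrow> bool" where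
  "attached I p C \<longleftrightarrow> p = [] \<and> Start C \<in> I \<or> (\<exists>i. Extension C p i \<in> I)"

definition lit_at ::
  "('f, 'p, 'v) atom set \<Rightarrow> pos \<Rightarrow> ('f, 'p, pos \<times> 'v) literal \<Rightarrow> bool" where
  "lit_at I q L \<longleftrightarrow>
     (\<exists>p i C. q = p @ [i] \<and> attached I p C \<and> i < length C \<and> L = rename p (C ! i))"

text \<open>The atom-level part of being an open branch: nothing acts at \<open>p\<close>, and
  \<open>p\<close> is not the connected child of an extension. That \<open>p\<close> is a node at
  all is a separate condition, added in \<open>represents_open_branch\<close>.\<close>

definition open_at :: "('f, 'p, 'v) atom set \<Rightarrow> pos \<Rightarrow> bool" where
  "open_at I p \<longleftrightarrow>
     (\<forall>j \<in> I. acts_at j \<noteq> p) \<and> (\<forall>C q i. Extension C q i \<in> I \<longrightarrow> p \<noteq> q @ [i])"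

text \<open>The side conditions that can be stated without an order of application. They refer to
  literals only by their existence in the whole set, so they are monotone in \<open>I\<close>; depth
  and unifiability are kept apart in \<open>fits\<close> and \<open>satisfies\<close>.\<close>

primrec valid ::
  "('f, 'p, 'v) clause set \<Rightarrow> ('f, 'p, 'v) atom set \<Rightarrow> ('f, 'p, 'v) atom \<Rightarrow> bool" where
  "valid S I (Start C) \<longleftrightarrow> C \<in> S"
| "valid S I (Reduction q p) \<longleftrightarrow>
     strict_prefix q p \<and> (\<exists>L. lit_at I q L) \<and> (\<exists>L. lit_at I p L)"
| "valid S I (Extension C p i) \<longleftrightarrow> C \<in> S \<and> i < length C \<and> (\<exists>L. lit_at I p L)"

text \<open>Attaching below \<open>p\<close> creates nodes of length one more than that of
  \<open>p\<close>, unless the clause is empty. Only a start clause can be empty, since an extension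
  has a connected literal.\<close>

primrec fits :: "nat \<Rightarrow> ('f, 'p, 'v) atom \<Rightarrow> bool" where
  "fits d (Start C) \<longleftrightarrow> C = [] \<or> 0 < d"
| "fits d (Reduction q p) \<longleftrightarrow> True"
| "fits d (Extension C p i) \<longleftrightarrow> length p < d"

text \<open>At most one inference acts at each position, and connected children stay closed leaves.
  No order has to be recorded: a literal comes from a clause attached at the parent position, so the
  requirements in \<open>valid\<close> always lead to strictly shorter positions.\<close>

definition well_formed :: "('f, 'p, 'v) clause set \<Rightarrow> ('f, 'p, 'v) atom set \<Rightarrow> bool" where
  "well_formed S I \<longleftrightarrow> inj_on acts_at I \<and>
     (\<forall>j C q i. j \<in> I \<longrightarrow> Extension C q i \<in> I \<longrightarrow> acts_at j \<noteq> q @ [i]) \<and> (\<forall>j \<in> I. valid S I j)"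

text \<open>The literals are quantified universally so that the predicate is antitone in the atom
  set. In a well-formed set each position has at most one literal, so for a valid atom this is a
  single equation.\<close>

primrec satisfies ::
  "(pos \<times> 'v \<Rightarrow> ('f, pos \<times> 'v) tm) \<Rightarrow> ('f, 'p, 'v) atom set \<Rightarrow> ('f, 'p, 'v) atom \<Rightarrow> bool" where
  "satisfies \<theta> I (Start C) \<longleftrightarrow> True"
| "satisfies \<theta> I (Reduction q p) \<longleftrightarrow>
     (\<forall>L L1. lit_at I q L \<longrightarrow> lit_at I p L1 \<longrightarrow> subst_lit \<theta> (compl L) = subst_lit \<theta> L1)"
| "satisfies \<theta> I (Extension C p i) \<longleftrightarrow>
     (\<forall>L. lit_at I p L \<longrightarrow> subst_lit \<theta> (compl L) = subst_lit \<theta> (rename p (C ! i)))"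

definition solves ::
  "(pos \<times> 'v \<Rightarrow> ('f, pos \<times> 'v) tm) \<Rightarrow> ('f, 'p, 'v) atom set \<Rightarrow> bool" where
  "solves \<theta> I \<longleftrightarrow> (\<forall>j \<in> I. satisfies \<theta> I j)"

lemma attached_insert:
  "attached (insert (Start C) I) p D \<longleftrightarrow> p = [] \<and> D = C \<or> attached I p D"
  "attached (insert (Reduction q r) I) p D \<longleftrightarrow> attached I p D"
  "attached (insert (Extension C r i) I) p D \<longleftrightarrow> p = r \<and> D = C \<or> attached I p D"
  by (auto simp: attached_def)

lemma lit_at_insert:
  "lit_at (insert (Start C) I) q L \<longleftrightarrow>
     (\<exists>k < length C. q = [k] \<and> L = rename [] (C ! k)) \<or> lit_at I q L" (is ?s)
  "lit_at (insert (Reduction r p) I) q L \<longleftrightarrow> lit_at I q L" (is ?r)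
  "lit_at (insert (Extension C p i) I) q L \<longleftrightarrow>
     (\<exists>k < length C. q = p @ [k] \<and> L = rename p (C ! k)) \<or> lit_at I q L" (is ?e)
proof -
  have "lit_at (insert (Start C) I) q L \<longleftrightarrow>
      (\<exists>k < length C. q = [] @ [k] \<and> L = rename [] (C ! k)) \<or> lit_at I q L"
    unfolding lit_at_def attached_insert by blast
  then show ?s by simp
  show ?r unfolding lit_at_def attached_insert ..
  show ?e unfolding lit_at_def attached_insert by blast
qed

lemma lit_atI: "attached I p C \<Longrightarrow> i < length C \<Longrightarrow> lit_at I (p @ [i]) (rename p (C ! i))"
  unfolding lit_at_def by blast


lemma attached_mono: "I \<subseteq> J \<Longrightarrow> attached I p C \<Longrightarrow> attached J p C"
  by (auto simp: attached_def)

lemma lit_at_mono: "I \<subseteq> J \<Longrightarrow> lit_at I p L \<Longrightarrow> lit_at J p L"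
  unfolding lit_at_def using attached_mono by blast

lemma attached_acts_at: "attached I p C \<Longrightarrow> \<exists>j \<in> I. acts_at j = p"
  by (force simp: attached_def)

lemma attached_functional:
  assumes "inj_on acts_at I" "attached I p C" "attached I p D"
  shows "C = D"
proof -
  obtain j where j: "j \<in> I" "acts_at j = p" "j = Start C \<or> (\<exists>i. j = Extension C p i)"
    using assms(2) by (force simp: attached_def)
  obtain k where k: "k \<in> I" "acts_at k = p" "k = Start D \<or> (\<exists>i. k = Extension D p i)"
    using assms(3) by (force simp: attached_def)
  have "j = k" using inj_onD[OF assms(1)] j k by simp
  with j(3) k(3) show ?thesis by (elim disjE exE) simp_all
qed

lemma lit_at_functional:
  assumes "inj_on acts_at I" "lit_at I q L" "lit_at I q L'"
  shows "L = L'"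
proof -
  obtain p i C where "q = p @ [i]" "attached I p C" "L = rename p (C ! i)"
    using assms(2) by (auto simp: lit_at_def)
  moreover obtain D where "attached I p D" "L' = rename p (D ! i)"
    using assms(3) \<open>q = p @ [i]\<close> by (auto simp: lit_at_def)
  ultimately show ?thesis using attached_functional[OF assms(1)] by blast
qed

lemma lit_at_not_root: "\<not> lit_at I [] L"
  by (simp add: lit_at_def)

lemma lit_at_superset_iff:
  assumes "I \<subseteq> J" "inj_on acts_at J" "lit_at I q L0"
  shows "lit_at J q L \<longleftrightarrow> lit_at I q L"
  using lit_at_functional[OF assms(2) lit_at_mono[OF assms(1,3)]] lit_at_mono[OF assms(1)] assms(3)
  by blast

lemma valid_mono: "I \<subseteq> J \<Longrightarrow> valid S I j \<Longrightarrow> valid S J j"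
  by (cases j) (auto intro: lit_at_mono)

lemma valid_lit_at: "valid S I j \<Longrightarrow> acts_at j = [] \<or> (\<exists>L. lit_at I (acts_at j) L)"
  by (cases j) auto

lemma satisfies_antimono: "I \<subseteq> J \<Longrightarrow> satisfies \<theta> J j \<Longrightarrow> satisfies \<theta> I j"
  by (cases j) (auto dest: lit_at_mono)

text \<open>Validity in \<open>I\<close> provides the literals to which \<open>j\<close> refers, and
  injectivity on \<open>J\<close> excludes further literals at these positions, so the two
  conditions are the same equation.\<close>

lemma satisfies_superset_iff:
  assumes "I \<subseteq> J" "inj_on acts_at J" "valid S I j"
  shows "satisfies \<theta> J j \<longleftrightarrow> satisfies \<theta> I j"
proof (cases j)
  case (Reduction q p)
  then show ?thesis using assms lit_at_superset_iff[OF assms(1,2)] by (auto; metis)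
next
  case (Extension C p i)
  then show ?thesis using assms lit_at_superset_iff[OF assms(1,2)] by (auto; metis)
qed simp

lemma well_formed_valid: "well_formed S I \<Longrightarrow> j \<in> I \<Longrightarrow> valid S I j"
  by (simp add: well_formed_def)

lemma well_formed_inj: "well_formed S I \<Longrightarrow> inj_on acts_at I"
  by (simp add: well_formed_def)

lemma acting_parent_attached:
  assumes "well_formed S I" "j \<in> I"
  shows "acts_at j = [] \<or> (\<exists>C. attached I (butlast (acts_at j)) C)"
  using valid_lit_at[OF well_formed_valid[OF assms]] by (auto simp: lit_at_def)

text \<open>Take an atom acting at a shortest position. If this were not the root, the atom
  attaching the clause at its parent would act at a shorter one.\<close>

lemma well_formed_root:
  assumes "well_formed S I" "I \<noteq> {}"
  shows "\<exists>j \<in> I. acts_at j = []"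
proof -
  obtain j where j: "j \<in> I" and min: "\<And>k. k \<in> I \<Longrightarrow> length (acts_at j) \<le> length (acts_at k)"
    using assms(2) ex_has_least_nat[of "\<lambda>j. j \<in> I" _ "length \<circ> acts_at"] by auto
  have "acts_at j = []"
  proof (rule ccontr)
    assume ne: "acts_at j \<noteq> []"
    then obtain k where "k \<in> I" "acts_at k = butlast (acts_at j)"
      using acting_parent_attached[OF assms(1) j] attached_acts_at by blast
    with min[of k] ne show False by (cases "acts_at j" rule: rev_cases) auto
  qed
  with j show ?thesis by blast
qed

lemma well_formed_insert:
  assumes wf: "well_formed S I" and op: "open_at I (acts_at j)" and v: "valid S I j"
  shows "well_formed S (insert j I)"
proof -
  have "inj_on acts_at (insert j I)"
    using well_formed_inj[OF wf] op by (auto simp: open_at_def inj_on_insert)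
  moreover have "\<forall>k \<in> insert j I. valid S (insert j I) k"
    using v well_formed_valid[OF wf] valid_mono[OF subset_insertI] by blast
  moreover have "acts_at k \<noteq> q @ [i]"
    if k: "k \<in> insert j I" and e: "Extension C q i \<in> insert j I" for k C q i
  proof
    assume eq: "acts_at k = q @ [i]"
    consider "k = j" "Extension C q i = j" | "k = j" "Extension C q i \<in> I"
      | "k \<in> I" "Extension C q i = j" | "k \<in> I" "Extension C q i \<in> I"
      using k e by blast
    then show False
    proof cases
      case 1
      then show False using eq by auto
    next
      case 2
      then show False using eq op by (auto simp: open_at_def)
    \<comment> \<open>An older inference acting at a child of \<open>q\<close> would need a clause
      attached at \<open>q\<close>, whereas \<open>j\<close> itself acts at \<open>q\<close>, which
      was open.\<close>
    next
      case 3
      then have "acts_at j = q" by auto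
      moreover obtain D where "attached I q D"
        using acting_parent_attached[OF wf 3(1)] eq by auto
      ultimately show False using attached_acts_at op by (auto simp: open_at_def)
    next
      case 4
      then show False using eq wf by (auto simp: well_formed_def)
    qed
  qed
  ultimately show ?thesis by (simp add: well_formed_def)
qed

lemma solves_subset: "I \<subseteq> J \<Longrightarrow> solves \<theta> J \<Longrightarrow> solves \<theta> I"
  unfolding solves_def using satisfies_antimono by blast

text \<open>A new inference adds one equation and changes none of the old ones, because all atoms
  involved are valid already in \<open>I\<close>. Thus the solutions of a set of connections do not
  depend on the order in which they were made.\<close>

lemma solves_insert:
  assumes wf: "well_formed S I" and op: "open_at I (acts_at j)" and v: "valid S I j"
  shows "solves \<theta> (insert j I) \<longleftrightarrow> solves \<theta> I \<and> satisfies \<theta> I j"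
proof -
  have "inj_on acts_at (insert j I)"
    using well_formed_insert[OF assms] by (rule well_formed_inj)
  then have "satisfies \<theta> (insert j I) k \<longleftrightarrow> satisfies \<theta> I k" if "k \<in> insert j I" for k
    using that v well_formed_valid[OF wf] by (intro satisfies_superset_iff) auto
  then show ?thesis by (auto simp: solves_def)
qed

text \<open>A derivable tableau is determined by its set of atoms, except that its substitution is only
  determined up to renaming: it is a most general simultaneous unifier of all connections.\<close>

definition represents ::
  "('f, 'p, 'v) clause set \<Rightarrow> nat \<Rightarrow> ('f, 'p, 'v) atom set \<Rightarrow> ('f, 'p, 'v) tableau \<Rightarrow> bool" where
  "represents S d I T \<longleftrightarrow> well_formed S I \<and> within_depth d T \<and> (I = {} \<longrightarrow> T = empty_tableau) \<and>
     (\<forall>q L. label T q = Some L \<longleftrightarrow> lit_at I q L) \<and>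
     expanded T = {p. \<exists>C. attached I p C} \<and>
     closed_leaves T = {p. (\<exists>q. Reduction q p \<in> I) \<or> (\<exists>C q i. Extension C q i \<in> I \<and> p = q @ [i])} \<and>
     (\<forall>\<theta>. solves \<theta> I \<longleftrightarrow> (\<exists>\<gamma>. \<theta> = subst_comp \<gamma> (global_subst T)))"

lemma represents_empty: "represents S d {} empty_tableau"
  by (auto simp: represents_def well_formed_def within_depth_def nodes_def empty_tableau_def
      lit_at_def attached_def solves_def subst_comp_Var_right)

lemma represents_open_branch:
  assumes "represents S d I T"
  shows "open_branch T p \<longleftrightarrow> (p = [] \<or> (\<exists>L. lit_at I p L)) \<and> open_at I p"
proof -
  have "(\<exists>j \<in> I. acts_at j = p) \<longleftrightarrow> (\<exists>C. attached I p C) \<or> (\<exists>q. Reduction q p \<in> I)"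
  proof
    assume "\<exists>j \<in> I. acts_at j = p"
    then obtain j where "j \<in> I" "acts_at j = p" by blast
    then show "(\<exists>C. attached I p C) \<or> (\<exists>q. Reduction q p \<in> I)"
      by (cases j) (auto simp: attached_def)
  next
    assume "(\<exists>C. attached I p C) \<or> (\<exists>q. Reduction q p \<in> I)"
    then show "\<exists>j \<in> I. acts_at j = p" using attached_acts_at by force
  qed
  then show ?thesis
    using assms unfolding represents_def open_branch_def nodes_def open_at_def
    by (auto simp: dom_def)
qed

lemma represents_solves:
  assumes "represents S d I T"
  shows "solves (global_subst T) I"
proof -
  have "\<exists>\<gamma>. global_subst T = subst_comp \<gamma> (global_subst T)"
    by (intro exI[of _ Var]) (simp add: subst_comp_Var_left)
  then show ?thesis using assms by (simp add: represents_def)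
qed

lemma represents_length:
  assumes "represents S d I T" "lit_at I p L"
  shows "length p \<le> d"
  using assms by (auto simp: represents_def within_depth_def nodes_def dom_def)

section \<open>Single inference steps in terms of atom sets\<close>

lemma label_attach:
  "label (attach p C T) q = Some L \<longleftrightarrow>
     (\<exists>i < length C. q = p @ [i] \<and> L = rename p (C ! i)) \<or>
     label T q = Some L \<and> (\<forall>i < length C. q \<noteq> p @ [i])"
proof -
  let ?m = "map_of (map (\<lambda>i. (p @ [i], rename p (C ! i))) [0..<length C])"
  have lab: "label (attach p C T) = label T ++ ?m" by (simp add: attach_def)
  show ?thesis
  proof (cases "\<exists>i < length C. q = p @ [i]")
    case True
    then obtain i where i: "i < length C" "q = p @ [i]" by blast
    then have "?m q = Some (rename p (C ! i))"
      by (intro map_of_is_SomeI) (auto simp: distinct_map inj_on_def comp_def)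
    then show ?thesis using i by (auto simp: lab)
  next
    case False
    then have "?m q = None" by (auto simp: map_of_eq_None_iff)
    then show ?thesis using False by (auto simp: lab map_add_def)
  qed
qed

lemma within_depth_attach:
  assumes "within_depth d T"
  shows "within_depth d (attach p C T) \<longleftrightarrow> C = [] \<or> length p < d"
proof -
  have "dom (label (attach p C T)) = dom (label T) \<union> {p @ [i] | i. i < length C}"
    by (auto simp: dom_def label_attach)
  then have "nodes (attach p C T) = nodes T \<union> {p @ [i] | i. i < length C}"
    by (auto simp: nodes_def)
  then have "within_depth d (attach p C T) \<longleftrightarrow> (\<forall>i < length C. length (p @ [i]) \<le> d)"
    using assms unfolding within_depth_def by blast
  then show ?thesis by auto
qed

lemma within_depth_simps:
  "within_depth d (extend_subst \<mu> T) \<longleftrightarrow> within_depth d T"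
  "within_depth d (close_leaf p T) \<longleftrightarrow> within_depth d T"
  by (simp_all add: within_depth_def nodes_def extend_subst_def close_leaf_def)

text \<open>A solution of \<open>P\<close> is an instance of \<open>\<sigma>\<close> by some
  \<open>\<gamma>\<close>. It equates \<open>K\<close> and \<open>L\<close> exactly when
  \<open>\<gamma>\<close> unifies their \<open>\<sigma>\<close>-instances, that is, when
  \<open>\<gamma>\<close> factors through \<open>\<mu>\<close>. This carries the description of all
  solutions through one inference.\<close>

lemma subst_comp_mgu_iff:
  fixes P :: "('v \<Rightarrow> ('f, 'v) tm) \<Rightarrow> bool" and \<sigma> :: "'v \<Rightarrow> ('f, 'v) tm"
  assumes P: "\<And>\<theta>. P \<theta> \<longleftrightarrow> (\<exists>\<gamma>. \<theta> = subst_comp \<gamma> \<sigma>)"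
    and mgu: "is_mgu \<mu> (subst_lit \<sigma> K) (subst_lit \<sigma> L)"
  shows "P \<theta> \<and> subst_lit \<theta> K = subst_lit \<theta> L \<longleftrightarrow> (\<exists>\<gamma>. \<theta> = subst_comp \<gamma> (subst_comp \<mu> \<sigma>))"
proof
  assume "P \<theta> \<and> subst_lit \<theta> K = subst_lit \<theta> L"
  then obtain \<gamma> where \<gamma>: "\<theta> = subst_comp \<gamma> \<sigma>" "subst_lit \<theta> K = subst_lit \<theta> L" using P by blast
  then have "subst_lit \<gamma> (subst_lit \<sigma> K) = subst_lit \<gamma> (subst_lit \<sigma> L)" by (simp add: subst_lit_comp)
  then obtain \<delta> where "\<gamma> = subst_comp \<delta> \<mu>" using mgu unfolding is_mgu_def by blast
  then show "\<exists>\<gamma>. \<theta> = subst_comp \<gamma> (subst_comp \<mu> \<sigma>)" using \<gamma> subst_comp_assoc by metis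
next
  assume "\<exists>\<gamma>. \<theta> = subst_comp \<gamma> (subst_comp \<mu> \<sigma>)"
  then obtain \<gamma> where \<gamma>: "\<theta> = subst_comp \<gamma> (subst_comp \<mu> \<sigma>)" by blast
  have "subst_lit \<mu> (subst_lit \<sigma> K) = subst_lit \<mu> (subst_lit \<sigma> L)" using mgu by (simp add: is_mgu_def)
  then have "subst_lit \<theta> K = subst_lit \<theta> L"
    unfolding \<gamma> by (simp flip: subst_lit_comp)
  moreover have "P \<theta>" using P \<gamma> subst_comp_assoc by metis
  ultimately show "P \<theta> \<and> subst_lit \<theta> K = subst_lit \<theta> L" by blast
qed

text \<open>Replaces a condition on the particular global substitution by joint solvability, which
  no longer depends on the unifiers chosen earlier.\<close>

lemma mgu_exists_iff:
  fixes P :: "('v \<Rightarrow> ('f, 'v) tm) \<Rightarrow> bool" and \<sigma> :: "'v \<Rightarrow> ('f, 'v) tm"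
  assumes P: "\<And>\<theta>. P \<theta> \<longleftrightarrow> (\<exists>\<gamma>. \<theta> = subst_comp \<gamma> \<sigma>)"
  shows "(\<exists>\<mu>. is_mgu \<mu> (subst_lit \<sigma> K) (subst_lit \<sigma> L)) \<longleftrightarrow>
    (\<exists>\<theta>. P \<theta> \<and> subst_lit \<theta> K = subst_lit \<theta> L)"
proof
  assume "\<exists>\<mu>. is_mgu \<mu> (subst_lit \<sigma> K) (subst_lit \<sigma> L)"
  then show "\<exists>\<theta>. P \<theta> \<and> subst_lit \<theta> K = subst_lit \<theta> L"
    using subst_comp_mgu_iff[of P, OF P] by blast
next
  assume "\<exists>\<theta>. P \<theta> \<and> subst_lit \<theta> K = subst_lit \<theta> L"
  then show "\<exists>\<mu>. is_mgu \<mu> (subst_lit \<sigma> K) (subst_lit \<sigma> L)"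
    using P is_mgu_exists by (metis subst_lit_comp)
qed

lemma satisfies_Reduction_iff:
  assumes "inj_on acts_at I" "lit_at I q L" "lit_at I p L1"
  shows "satisfies \<theta> I (Reduction q p) \<longleftrightarrow> subst_lit \<theta> (compl L) = subst_lit \<theta> L1"
  using assms lit_at_functional[OF assms(1)] unfolding satisfies.simps by blast

lemma satisfies_Extension_iff:
  assumes "inj_on acts_at I" "lit_at I p L"
  shows "satisfies \<theta> I (Extension C p i) \<longleftrightarrow>
    subst_lit \<theta> (compl L) = subst_lit \<theta> (rename p (C ! i))"
  using assms lit_at_functional[OF assms(1)] unfolding satisfies.simps by blast

text \<open>The right-hand side mentions only the atom set and not \<open>T\<close>. Hence all
  tableaux represented by the same set admit the same inferences, however they were derived.\<close>

lemma applicable_iff: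
  assumes rep: "represents S d I T"
  shows "applicable S d j T \<longleftrightarrow>
    open_at I (acts_at j) \<and> valid S I j \<and> fits d j \<and> (\<exists>\<theta>. solves \<theta> (insert j I))"
    (is "_ \<longleftrightarrow> ?enabled")
proof -
  have wf: "well_formed S I" and depth: "within_depth d T"
    and lab: "\<And>q L. label T q = Some L \<longleftrightarrow> lit_at I q L"
    and sol: "\<And>\<theta>. solves \<theta> I \<longleftrightarrow> (\<exists>\<gamma>. \<theta> = subst_comp \<gamma> (global_subst T))"
    using rep by (auto simp: represents_def)
  note op = represents_open_branch[OF rep]
  note inj = well_formed_inj[OF wf]
  note mgu = mgu_exists_iff[of "\<lambda>\<theta>. solves \<theta> I", OF sol]
  have sol': "(\<exists>\<theta>. solves \<theta> (insert j I)) \<longleftrightarrow> (\<exists>\<theta>. solves \<theta> I \<and> satisfies \<theta> I j)"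
    if "open_at I (acts_at j)" "valid S I j"
    using solves_insert[OF wf that] by blast
  show ?thesis
  proof (cases j)
    case (Start C)
    \<comment> \<open>The start rule asks for the empty tableau, not for an open root. The two agree
      because every nonempty well-formed set has an atom acting at the root.\<close>
    have "T = empty_tableau \<longleftrightarrow> open_at I []"
    proof
      assume "T = empty_tableau"
      then have "open_branch T []" by (simp add: open_branch_def nodes_def empty_tableau_def)
      then show "open_at I []" using op by blast
    next
      assume "open_at I []"
      then have "I = {}" using well_formed_root[OF wf] by (auto simp: open_at_def)
      then show "T = empty_tableau" using rep by (simp add: represents_def)
    qed
    moreover have "\<exists>\<theta>. solves \<theta> (insert j I)" if "open_at I []" "C \<in> S"
      using that Start represents_solves[OF rep] solves_insert[OF wf, of j] by auto
    moreover have "applicable S d j T \<longleftrightarrow>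
        T = empty_tableau \<and> C \<in> S \<and> within_depth d (attach [] C T)"
      unfolding applicable_def Start by (auto elim: infer.cases intro: infer.start)
    ultimately show ?thesis
      using Start within_depth_attach[OF depth] by auto
  next
    case (Reduction q p)
    have "applicable S d j T \<longleftrightarrow> (\<exists>L L1. open_branch T p \<and> strict_prefix q p \<and>
        lit_at I q L \<and> lit_at I p L1 \<and> (\<exists>\<mu>. is_mgu \<mu> (subst_lit (global_subst T) (compl L))
          (subst_lit (global_subst T) L1)))"
      unfolding applicable_def Reduction
      by (force elim!: infer.cases intro: infer.reduction simp: within_depth_simps depth
          simp flip: lab)
    also have "\<dots> \<longleftrightarrow> (\<exists>L L1. open_branch T p \<and> strict_prefix q p \<and>
        lit_at I q L \<and> lit_at I p L1 \<and> (\<exists>\<theta>. solves \<theta> I \<and> satisfies \<theta> I j))"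
      unfolding mgu Reduction using satisfies_Reduction_iff[OF inj] by blast
    also have "\<dots> \<longleftrightarrow> ?enabled"
      using op sol' Reduction by (auto simp del: satisfies.simps)
    finally show ?thesis .
  next
    case (Extension C p i)
    have "applicable S d j T \<longleftrightarrow> (\<exists>L. open_branch T p \<and> C \<in> S \<and> i < length C \<and>
        length p < d \<and> lit_at I p L \<and> (\<exists>\<mu>. is_mgu \<mu> (subst_lit (global_subst T) (compl L))
          (subst_lit (global_subst T) (rename p (C ! i)))))"
      unfolding applicable_def Extension
      by (force elim!: infer.cases intro: infer.extension
          simp: within_depth_simps within_depth_attach depth simp flip: lab)
    also have "\<dots> \<longleftrightarrow> (\<exists>L. open_branch T p \<and> C \<in> S \<and> i < length C \<and>
        length p < d \<and> lit_at I p L \<and> (\<exists>\<theta>. solves \<theta> I \<and> satisfies \<theta> I j))"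
      unfolding mgu Extension using satisfies_Extension_iff[OF inj] by blast
    also have "\<dots> \<longleftrightarrow> ?enabled"
      using op sol' Extension by (auto simp del: satisfies.simps)
    finally show ?thesis .
  qed
qed

lemma infer_represents:
  assumes rep: "represents S d I T" and inf: "infer S d j T T'"
  shows "represents S d (insert j I) T'" and "j \<notin> I"
proof -
  have wf: "well_formed S I"
    and lab: "\<And>q L. label T q = Some L \<longleftrightarrow> lit_at I q L"
    and exp: "expanded T = {p. \<exists>C. attached I p C}"
    and clo: "closed_leaves T =
      {p. (\<exists>q. Reduction q p \<in> I) \<or> (\<exists>C q i. Extension C q i \<in> I \<and> p = q @ [i])}"
    and sol: "\<And>\<theta>. solves \<theta> I \<longleftrightarrow> (\<exists>\<gamma>. \<theta> = subst_comp \<gamma> (global_subst T))"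
    using rep by (auto simp: represents_def)
  have op: "open_at I (acts_at j)" and v: "valid S I j"
    using inf applicable_iff[OF rep, of j] by (auto simp: applicable_def)
  show "j \<notin> I" using op by (auto simp: open_at_def)
  note inj = well_formed_inj[OF wf]
  note mgu = subst_comp_mgu_iff[of "\<lambda>\<theta>. solves \<theta> I", OF sol]
  \<comment> \<open>The children of an open branch carry no literals yet, so attaching a clause
    overwrites no label.\<close>
  have unattached: "\<not> lit_at I (acts_at j @ [i]) L" for i L
    using op attached_acts_at unfolding lit_at_def open_at_def by fastforce
  note wf' = well_formed_insert[OF wf op v] and sol' = solves_insert[OF wf op v]
  show "represents S d (insert j I) T'"
    using inf
  proof cases
    case (start C)
    have "(label T' q = Some L) = lit_at (insert j I) q L" for q L
      using start lab unattached by (auto simp: label_attach lit_at_insert)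
    moreover have "(solves \<theta> (insert j I)) = (\<exists>\<gamma>. \<theta> = subst_comp \<gamma> (global_subst T'))" for \<theta>
      using sol' sol start by (simp add: attach_def)
    moreover have "expanded T' = {p. \<exists>C. attached (insert j I) p C}"
      using exp start by (auto simp: attach_def attached_insert)
    moreover have "closed_leaves T' = {p. (\<exists>q. Reduction q p \<in> insert j I) \<or>
        (\<exists>C q i. Extension C q i \<in> insert j I \<and> p = q @ [i])}"
      using clo start by (auto simp: attach_def)
    ultimately show ?thesis using wf' start by (simp add: represents_def)
  next
    case (reduction p L1 q L \<mu>)
    have "(label T' q = Some L) = lit_at (insert j I) q L" for q L
      using reduction lab by (auto simp: extend_subst_def close_leaf_def lit_at_insert)
    moreover have "(solves \<theta> (insert j I)) = (\<exists>\<gamma>. \<theta> = subst_comp \<gamma> (global_subst T'))" for \<theta>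
      using sol' mgu[OF reduction(6)] reduction satisfies_Reduction_iff[OF inj] lab
      by (simp add: extend_subst_def close_leaf_def)
    moreover have "expanded T' = {p. \<exists>C. attached (insert j I) p C}"
      using exp reduction by (auto simp: extend_subst_def close_leaf_def attached_insert)
    moreover have "closed_leaves T' = {p. (\<exists>q. Reduction q p \<in> insert j I) \<or>
        (\<exists>C q i. Extension C q i \<in> insert j I \<and> p = q @ [i])}"
      using clo reduction by (auto simp: extend_subst_def close_leaf_def)
    ultimately show ?thesis using wf' reduction by (simp add: represents_def)
  next
    case (extension p L C i \<mu>)
    have "(label T' q = Some L) = lit_at (insert j I) q L" for q L
      using extension lab unattached label_attach[of p C T q L]
      by (auto simp: extend_subst_def close_leaf_def lit_at_insert)
    moreover have "(solves \<theta> (insert j I)) = (\<exists>\<gamma>. \<theta> = subst_comp \<gamma> (global_subst T'))" for \<theta>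
      using sol' mgu[OF extension(6)] extension satisfies_Extension_iff[OF inj] lab
      by (simp add: extend_subst_def close_leaf_def attach_def)
    moreover have "expanded T' = {p. \<exists>C. attached (insert j I) p C}"
      using exp extension by (auto simp: extend_subst_def close_leaf_def attach_def attached_insert)
    moreover have "closed_leaves T' = {p. (\<exists>q. Reduction q p \<in> insert j I) \<or>
        (\<exists>C q i. Extension C q i \<in> insert j I \<and> p = q @ [i])}"
      using clo extension by (auto simp: extend_subst_def close_leaf_def attach_def)
    ultimately show ?thesis using wf' extension by (simp add: represents_def)
  qed
qed

lemma infers_represents:
  assumes "represents S d I T" "infers S d js T T'"
  shows "represents S d (I \<union> set js) T'" and "distinct js" and "set js \<inter> I = {}"
proof -
  have "represents S d (I \<union> set js) T' \<and> distinct js \<and> set js \<inter> I = {}"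
    using assms
  proof (induction js arbitrary: I T)
    case (Cons j js)
    then obtain U where U: "infer S d j T U" "infers S d js U T'" by auto
    note step = infer_represents[OF Cons.prems(1) U(1)]
    show ?case using Cons.IH[OF step(1) U(2)] step(2) by auto
  qed simp
  then show "represents S d (I \<union> set js) T'" "distinct js" "set js \<inter> I = {}" by auto
qed

section \<open>Replaying derivations\<close>

lemma ancestor_lit_at:
  assumes wf: "well_formed S I" and "lit_at I p L" "prefix q p" "q \<noteq> []"
  shows "\<exists>L. lit_at I q L"
  using assms(2-)
proof (induction p arbitrary: L rule: rev_induct)
  case Nil
  then show ?case by (simp add: lit_at_not_root)
next
  case (snoc i p)
  show ?case
  proof (cases "q = p @ [i]")
    case True
    then show ?thesis using snoc.prems by blast
  next
    case False
    then have q: "prefix q p" using snoc.prems by simp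
    then have "p \<noteq> []" using snoc.prems by auto
    moreover obtain C where "attached I p C" using snoc.prems(1) by (auto simp: lit_at_def)
    ultimately obtain L' where "lit_at I p L'"
      using attached_acts_at valid_lit_at well_formed_valid[OF wf] by blast
    then show ?thesis using snoc.IH q snoc.prems(3) by blast
  qed
qed

text \<open>The literal at \<open>p\<close> is determined by the clause attached at the parent, and
  injectivity on \<open>J\<close> makes the clause found in \<open>I\<close> the same one.\<close>

lemma lit_at_subset:
  assumes "I \<subseteq> J" "inj_on acts_at J" "lit_at J p L" "attached I (butlast p) C"
  shows "lit_at I p L"
proof -
  obtain q i D where p: "p = q @ [i]" "attached J q D" "i < length D" "L = rename q (D ! i)"
    using assms(3) by (auto simp: lit_at_def)
  moreover have "C = D"
    using attached_functional[OF assms(2)] attached_mono[OF assms(1,4)] p by simp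
  ultimately show ?thesis using assms(4) lit_atI by auto
qed

text \<open>Every condition of \<open>applicable_iff\<close> is inherited from \<open>J\<close>. The
  branch is open because no other atom of \<open>J\<close> acts there or closes it; its literal
  comes from the parent clause, and a reduction target is an ancestor; the depth bound holds because
  the attached nodes occur in \<open>U\<close>; the global substitution of \<open>U\<close> solves
  all connections at once.\<close>

lemma applicable_from_superset:
  assumes J: "represents S d J U" and I: "represents S d I T" and sub: "I \<subseteq> J"
    and j: "j \<in> J" "j \<notin> I"
    and parent: "acts_at j = [] \<or> (\<exists>C. attached I (butlast (acts_at j)) C)"
  shows "applicable S d j T"
proof -
  have wfJ: "well_formed S J" and wfI: "well_formed S I"
    using I J by (auto simp: represents_def)
  note inj = well_formed_inj[OF wfJ]
  have vJ: "valid S J j" using wfJ j(1) by (rule well_formed_valid)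
  have "open_at I (acts_at j)"
    using wfJ sub j inj_onD[OF inj] unfolding open_at_def well_formed_def by blast
  moreover have lit: "lit_at I (acts_at j) L" if "lit_at J (acts_at j) L" for L
    using lit_at_subset[OF sub inj that] parent that by (auto simp: lit_at_not_root)
  have "valid S I j"
  proof (cases j)
    case (Reduction q p)
    with vJ obtain L L1 where q: "strict_prefix q p" "lit_at J q L" "lit_at J p L1" by auto
    then have p: "lit_at I p L1" using lit Reduction by simp
    moreover have "\<exists>L. lit_at I q L"
      using ancestor_lit_at[OF wfI p, of q] q lit_at_not_root by (auto simp: strict_prefix_def)
    ultimately show ?thesis using Reduction q(1) by auto
  qed (use vJ lit in auto)
  moreover have "fits d j"
  proof (cases j)
    case (Start C)
    have "0 < d" if "C \<noteq> []"
    proof -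
      \<comment> \<open>The first literal of a nonempty start clause is a node of length one in
        \<open>U\<close>, which forces a positive depth limit.\<close>
      have "lit_at J [0] (rename [] (C ! 0))"
        using Start j(1) that lit_atI[of J "[]" C 0] by (simp add: attached_def)
      from represents_length[OF J this] show ?thesis by simp
    qed
    then show ?thesis using Start by auto
  next
    case (Extension C p i)
    then have "lit_at J (p @ [i]) (rename p (C ! i))"
      using j(1) vJ by (intro lit_atI) (auto simp: attached_def)
    from represents_length[OF J this] show ?thesis using Extension by simp
  qed simp
  moreover have "solves (global_subst U) (insert j I)"
    using solves_subset[OF _ represents_solves[OF J]] sub j(1) by simp
  ultimately show ?thesis using applicable_iff[OF I] by blast
qed

lemma infers_append: "infers S d (xs @ ys) T V \<longleftrightarrow> (\<exists>U. infers S d xs T U \<and> infers S d ys U V)"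
  by (induction xs arbitrary: T) auto

text \<open>Unifiability does not depend on the order of the connections, so any order of the atoms that
  respects the ancestor relation can be replayed.\<close>

lemma infers_dependency_closed:
  assumes J: "represents S d J U" and D: "finite D" "D \<subseteq> J"
    "\<And>j. j \<in> D \<Longrightarrow> acts_at j = [] \<or> (\<exists>C. attached D (butlast (acts_at j)) C)"
    and I: "represents S d I T" "I \<subseteq> D"
  shows "\<exists>js T'. distinct js \<and> set js = D - I \<and> infers S d js T T'"
  using I
proof (induction "card (D - I)" arbitrary: I T rule: less_induct)
  case less
  show ?case
  proof (cases "D - I = {}")
    case True
    then show ?thesis by (intro exI[of _ "[]"]) auto
  next
    case False
    \<comment> \<open>Among the missing atoms one at a shortest position is replayed next: whatever
      acts at its parent is shorter, hence already in \<open>I\<close>.\<close>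
    then obtain j where j: "j \<in> D - I"
      and min: "\<And>k. k \<in> D - I \<Longrightarrow> length (acts_at j) \<le> length (acts_at k)"
      using ex_has_least_nat[of "\<lambda>j. j \<in> D - I" _ "length \<circ> acts_at"] by auto
    have "acts_at j = [] \<or> (\<exists>C. attached I (butlast (acts_at j)) C)"
    proof (cases "acts_at j = []")
      case ne: False
      then obtain C where C: "attached D (butlast (acts_at j)) C" using D(3) j by blast
      have "k \<in> I" if "k \<in> D" "acts_at k = butlast (acts_at j)" for k
        using that min[of k] ne by (cases "acts_at j" rule: rev_cases) auto
      then have "attached I (butlast (acts_at j)) C"
        using C unfolding attached_def by (metis acts_at.simps(1,3))
      then show ?thesis by blast
    qed simp
    then have "applicable S d j T"
      using applicable_from_superset[OF J less.prems(1)] less.prems(2) D(2) j by blast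
    then obtain T1 where T1: "infer S d j T T1" by (auto simp: applicable_def)
    have "card (D - insert j I) < card (D - I)"
      using D(1) j by (intro psubset_card_mono) auto
    then obtain js T' where "distinct js" "set js = D - insert j I" "infers S d js T1 T'"
      using less.hyps[OF _ infer_represents(1)[OF less.prems(1) T1]] less.prems(2) j by blast
    then show ?thesis using T1 j by (intro exI[of _ "j # js"]) auto
  qed
qed

section \<open>Path inferences, failure reasons and closed derivations\<close>

lemma path_inferences_subset: "path_inferences I p \<subseteq> I"
  by (auto simp: path_inferences_def)

lemma path_inferences_acts_at: "j \<in> path_inferences I p \<Longrightarrow> acts_at j \<noteq> p"
  by (auto simp: path_inferences_def)

lemma attached_path_inferences:
  assumes "attached I q C" "strict_prefix q p"
  shows "attached (path_inferences I p) q C"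
  using assms by (auto simp: attached_def path_inferences_def)

lemma path_inferences_dependency_closed:
  assumes "well_formed S I" "j \<in> path_inferences I p"
  shows "acts_at j = [] \<or> (\<exists>C. attached (path_inferences I p) (butlast (acts_at j)) C)"
proof (cases "acts_at j = []")
  case False
  with assms(2) have "j \<in> I" "strict_prefix (acts_at j) p"
    by (auto simp: path_inferences_def)
  moreover from this obtain C where "attached I (butlast (acts_at j)) C"
    using acting_parent_attached[OF assms(1)] False by blast
  moreover have "strict_prefix (butlast (acts_at j)) (acts_at j)"
    using False by (metis append_butlast_last_id prefix_snoc prefix_order.dual_order.refl
        strict_prefix_def butlast_snoc not_Cons_self2 append_self_conv)
  ultimately show ?thesis
    using attached_path_inferences prefix_order.less_trans by blast
qed simp

lemma open_branch_parent:
  assumes "represents S d I T" "open_branch T p"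
  shows "p = [] \<or> (\<exists>C. attached (path_inferences I p) (butlast p) C)"
proof (cases "p = []")
  case False
  then obtain q i C where "p = q @ [i]" "attached I q C"
    using assms(2) unfolding represents_open_branch[OF assms(1)] lit_at_def by blast
  moreover from this have "strict_prefix q p" by (simp add: strict_prefix_def)
  ultimately show ?thesis using attached_path_inferences[of I q C p] by auto
qed simp

text \<open>The set \<open>J\<close> only supplies joint solvability and the depth bound. It is used
  both with the current atom set and with the atom set of a closed tableau.\<close>

lemma apply_all_path_inferences:
  assumes "represents S d J U" "path_inferences I p \<subseteq> J" "finite I" "well_formed S I"
  shows "\<exists>T. apply_all S d (path_inferences I p) empty_tableau T"
proof -
  have "finite (path_inferences I p)"
    using path_inferences_subset assms(3) by (rule finite_subset)
  then show ?thesis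
    using infers_dependency_closed[OF assms(1) _ assms(2) _ represents_empty empty_subsetI]
      path_inferences_dependency_closed[OF assms(4), of _ p]
    unfolding apply_all_def Diff_empty by meson
qed

lemma apply_all_represents:
  assumes "represents S d I T" "apply_all S d E T T'"
  shows "represents S d (I \<union> E) T'"
  using assms infers_represents(1) by (fastforce simp: apply_all_def)

text \<open>Applying all remaining atoms of \<open>I\<close> after the path rebuilds a tableau
  represented by \<open>I\<close>, so these atoms together prevent \<open>j\<close>. A preventing
  subset of least cardinality is then minimal under inclusion.\<close>

lemma failure_reason_exists:
  assumes rep: "represents S d I T" and fin: "finite I" and na: "\<not> applicable S d j T"
  shows "\<exists>E. failure_reason S d I p j E"
proof -
  let ?D = "path_inferences I p"
  have wf: "well_formed S I" using rep by (simp add: represents_def)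
  obtain T1 where T1: "apply_all S d ?D empty_tableau T1"
    using apply_all_path_inferences[OF rep path_inferences_subset fin wf] by blast
  have rep1: "represents S d ?D T1" using apply_all_represents[OF represents_empty T1] by simp
  obtain T2 where T2: "apply_all S d (I - ?D) T1 T2"
    using infers_dependency_closed[OF rep fin subset_refl _ rep1 path_inferences_subset]
      acting_parent_attached[OF wf] unfolding apply_all_def by meson
  have "represents S d I T2"
    using apply_all_represents[OF rep1 T2] path_inferences_subset[of I p] by (simp add: Un_absorb1)
  then have "\<not> applicable S d j T2" using na applicable_iff[OF rep, of j] applicable_iff[of S d I T2 j] by simp
  then have "prevents S d I p j (I - ?D)" using T1 T2 unfolding prevents_def by blast
  then obtain E where E: "E \<subseteq> I - ?D" "prevents S d I p j E"
    and min: "\<And>F. F \<subseteq> I - ?D \<Longrightarrow> prevents S d I p j F \<Longrightarrow> card E \<le> card F"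
    using ex_has_least_nat[of "\<lambda>E. E \<subseteq> I - ?D \<and> prevents S d I p j E" "I - ?D" card]
    by auto
  have "\<not> prevents S d I p j F" if "F \<subset> E" for F
  proof
    assume "prevents S d I p j F"
    then have "card E \<le> card F" using min that E(1) by blast
    moreover have "finite E" using E(1) fin by (meson finite_Diff finite_subset)
    ultimately show False using that psubset_card_mono by (metis not_le)
  qed
  with E have "failure_reason S d I p j E" by (simp add: failure_reason_def)
  then show ?thesis by (rule exI)
qed

text \<open>If \<open>E\<close> were contained in \<open>J\<close>, then the path together with
  \<open>E\<close> would be a part of \<open>J\<close> that attaches the parent of \<open>p\<close>
  and lacks \<open>j\<close>. By \<open>applicable_from_superset\<close>, \<open>j\<close> would
  still be applicable after \<open>E\<close>.\<close>

lemma failure_reason_not_in_derivation: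
  assumes I: "represents S d I T" "open_branch T p" and J: "represents S d J U"
    and j: "j \<in> J" "acts_at j = p" and D: "path_inferences I p \<subseteq> J"
    and E: "failure_reason S d I p j E"
  shows "\<not> E \<subseteq> J"
proof
  assume "E \<subseteq> J"
  have "E \<subseteq> I" and "prevents S d I p j E" using E by (auto simp: failure_reason_def)
  then obtain T1 T2 where T: "apply_all S d (path_inferences I p) empty_tableau T1"
      "apply_all S d E T1 T2" "\<not> applicable S d j T2"
    unfolding prevents_def by blast
  let ?K = "path_inferences I p \<union> E"
  have "represents S d ?K T2"
    using apply_all_represents[OF apply_all_represents[OF represents_empty T(1)] T(2)] by simp
  moreover have "j \<notin> I"
    using I(2) j(2) by (auto simp: represents_open_branch[OF I(1)] open_at_def)
  then have "j \<notin> ?K" using \<open>E \<subseteq> I\<close> path_inferences_subset by blast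
  moreover have "acts_at j = [] \<or> (\<exists>C. attached ?K (butlast (acts_at j)) C)"
    using open_branch_parent[OF I] j(2) attached_mono[OF Un_upper1] by blast
  ultimately show False
    using applicable_from_superset[OF J _ Un_least[OF D \<open>E \<subseteq> J\<close>] j(1)] T(3) by blast
qed

text \<open>The path to \<open>p\<close> lies in \<open>J\<close>, so \<open>p\<close> is also a
  node of \<open>U\<close>; if nothing acted there, it would be an open branch of
  \<open>U\<close>.\<close>

lemma closed_derivation_acts_at:
  assumes I: "represents S d I T" "open_branch T p" and J: "represents S d J U" "is_closed U"
    and D: "path_inferences I p \<subseteq> J"
  shows "\<exists>j \<in> J. acts_at j = p"
proof (rule ccontr)
  assume no: "\<not> ?thesis"
  have wfJ: "well_formed S J" and wfI: "well_formed S I"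
    using I J by (auto simp: represents_def)
  have op: "p = [] \<or> (\<exists>L. lit_at I p L)" "open_at I p"
    using I(2) by (simp_all add: represents_open_branch[OF I(1)])
  have "p = [] \<or> (\<exists>L. lit_at J p L)"
  proof (cases "p = []")
    case False
    then obtain q i C where p: "p = q @ [i]" "attached I q C" "i < length C"
      using op(1) unfolding lit_at_def by blast
    then have "strict_prefix q p" by (simp add: strict_prefix_def)
    then have "attached J q C" using attached_path_inferences attached_mono[OF D] p(2) by blast
    then show ?thesis using p lit_atI by blast
  qed simp
  moreover have "open_at J p"
    unfolding open_at_def
  proof (intro conjI allI impI)
    show "\<forall>j \<in> J. acts_at j \<noteq> p" using no by blast
    \<comment> \<open>Nor can \<open>p\<close> be closed in \<open>U\<close> as a connected child.
      The path atom acting at \<open>q\<close> would by injectivity on \<open>J\<close> be this very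
      extension, and then \<open>p\<close> would already be closed in \<open>T\<close>.\<close>
    fix C q i assume e: "Extension C q i \<in> J"
    show "p \<noteq> q @ [i]"
    proof
      assume p: "p = q @ [i]"
      then obtain D where "attached (path_inferences I p) q D"
        using open_branch_parent[OF I] by auto
      then obtain k where k: "k \<in> path_inferences I p" "acts_at k = q"
        using attached_acts_at by blast
      then have "k = Extension C q i"
        using e D inj_onD[OF well_formed_inj[OF wfJ]] by (metis acts_at.simps(3) subsetD)
      then show False using op(2) k p path_inferences_subset by (fastforce simp: open_at_def)
    qed
  qed
  ultimately have "open_branch U p" by (simp add: represents_open_branch[OF J(1)])
  then show False using J(2) by (simp add: is_closed_def)
qed

text \<open>Ensures that the loop at \<open>p\<close> really treats the inference that the closed
  derivation makes there, so that the learned constraint contains a reason against it.\<close>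

lemma closed_derivation_possible:
  assumes I: "represents S d I T" "open_branch T p" "finite I" and J: "represents S d J U"
    and D: "path_inferences I p \<subseteq> J" and j: "j \<in> J" "acts_at j = p"
  shows "j \<in> possible_inferences S d I p"
proof -
  have "well_formed S I" using I by (simp add: represents_def)
  then obtain T1 where T1: "apply_all S d (path_inferences I p) empty_tableau T1"
    using apply_all_path_inferences[OF J D I(3)] by blast
  have "represents S d (path_inferences I p) T1"
    using apply_all_represents[OF represents_empty T1] by simp
  then have "applicable S d j T1"
    using applicable_from_superset[OF J _ D j(1)] j(2) path_inferences_acts_at
      open_branch_parent[OF I(1,2)] by blast
  then show ?thesis using T1 j(2) by (auto simp: possible_inferences_def)
qed

section \<open>Invariant and termination of the search\<close>

definition literal_indices :: "('f, 'p, 'v) clause set \<Rightarrow> nat set" where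
  "literal_indices S = (\<Union>C \<in> S. {..<length C})"

definition bounded_positions :: "('f, 'p, 'v) clause set \<Rightarrow> nat \<Rightarrow> pos set" where
  "bounded_positions S d = {p. set p \<subseteq> literal_indices S \<and> length p \<le> d}"

text \<open>A finite overapproximation of the atoms that can occur within the depth limit. It bounds
  both the length of the trail and the number of constraints.\<close>

definition atom_space :: "('f, 'p, 'v) clause set \<Rightarrow> nat \<Rightarrow> ('f, 'p, 'v) atom set" where
  "atom_space S d = Start ` S \<union>
     (\<lambda>(q, p). Reduction q p) ` (bounded_positions S d \<times> bounded_positions S d) \<union>
     (\<lambda>(C, p, i). Extension C p i) ` (S \<times> bounded_positions S d \<times> literal_indices S)"

lemma finite_atom_space:
  assumes "finite S"
  shows "finite (atom_space S d)"
proof -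
  have "finite (literal_indices S)" using assms by (simp add: literal_indices_def)
  moreover from this have "finite (bounded_positions S d)"
    unfolding bounded_positions_def by (rule finite_lists_length_le)
  ultimately show ?thesis using assms by (simp add: atom_space_def)
qed

lemma attached_in_clauses:
  assumes "well_formed S I" "attached I p C"
  shows "C \<in> S"
  using assms(2) well_formed_valid[OF assms(1)] by (force simp: attached_def)

lemma lit_at_indices:
  assumes wf: "well_formed S I" and "lit_at I p L"
  shows "set p \<subseteq> literal_indices S"
  using assms(2)
proof (induction p arbitrary: L rule: rev_induct)
  case (snoc i p)
  obtain C where C: "attached I p C" "i < length C"
    using snoc.prems by (auto simp: lit_at_def)
  have "i \<in> literal_indices S"
    using C attached_in_clauses[OF wf] by (auto simp: literal_indices_def)
  moreover have "p = [] \<or> (\<exists>L. lit_at I p L)"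
    using attached_acts_at[OF C(1)] valid_lit_at[OF well_formed_valid[OF wf]] by blast
  ultimately show ?case using snoc.IH by auto
qed simp

lemma represents_atom_space:
  assumes rep: "represents S d I T"
  shows "I \<subseteq> atom_space S d"
proof
  fix j assume j: "j \<in> I"
  have wf: "well_formed S I" using rep by (simp add: represents_def)
  have pos: "p \<in> bounded_positions S d" if "lit_at I p L" for p L
    using represents_length[OF rep that] lit_at_indices[OF wf that]
    by (simp add: bounded_positions_def)
  have "valid S I j" using wf j by (rule well_formed_valid)
  then show "j \<in> atom_space S d"
    using pos by (cases j) (auto simp: atom_space_def literal_indices_def image_iff)
qed

lemma possible_inferences_atom_space: "possible_inferences S d I p \<subseteq> atom_space S d"
proof
  fix j assume "j \<in> possible_inferences S d I p"
  then obtain T T' where T: "apply_all S d (path_inferences I p) empty_tableau T" "infer S d j T T'"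
    by (auto simp: possible_inferences_def applicable_def)
  show "j \<in> atom_space S d"
    using represents_atom_space[OF infer_represents(1)[OF
        apply_all_represents[OF represents_empty T(1)] T(2)]] by simp
qed

section \<open>The trail, the loop over possible inferences, and backtracking\<close>

fun derived_trail ::
  "('f, 'p, 'v) clause set \<Rightarrow> nat \<Rightarrow> ('f, 'p, 'v) tableau \<Rightarrow> ('f, 'p, 'v) trail \<Rightarrow> bool" where
  "derived_trail S d T [] \<longleftrightarrow> T = empty_tableau"
| "derived_trail S d T ((j, T0) # tr) \<longleftrightarrow> infer S d j T0 T \<and> derived_trail S d T0 tr"

lemma derived_trail_infers:
  "derived_trail S d T tr \<Longrightarrow> infers S d (rev (map fst tr)) empty_tableau T"
  by (induction S d T tr rule: derived_trail.induct) (auto simp: infers_append)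

lemma derived_trail_represents:
  assumes "derived_trail S d T tr"
  shows "represents S d (trail_atoms tr) T" and "distinct (map fst tr)"
  using infers_represents[OF represents_empty derived_trail_infers[OF assms]]
  by (simp_all add: trail_atoms_def)

text \<open>The three facts serve different ends: the constraint contains the path to the branch, it
  is violated by the trail on which it is learned, and it holds an entry against each inference
  tried.\<close>

lemma try_each_Stuck:
  assumes "try_each S d s p js c0 (Stuck c)"
  shows "c0 \<subseteq> c"
    and "c0 \<subseteq> trail_atoms (trail s) \<Longrightarrow> c \<subseteq> trail_atoms (trail s)"
    and "j \<in> set js \<Longrightarrow> (\<exists>E. failure_reason S d (trail_atoms (trail s)) p j E \<and> E \<subseteq> c) \<or>
      (\<exists>c' \<in> learned s. c' - {j} \<subseteq> c)"
proof -
  have "c0 \<subseteq> c \<and> (c0 \<subseteq> trail_atoms (trail s) \<longrightarrow> c \<subseteq> trail_atoms (trail s)) \<and>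
    (\<forall>j \<in> set js. (\<exists>E. failure_reason S d (trail_atoms (trail s)) p j E \<and> E \<subseteq> c) \<or>
      (\<exists>c' \<in> learned s. c' - {j} \<subseteq> c))"
    using assms
  proof (induction js c0 "Stuck c" rule: try_each.induct)
    case (fails j E js c0)
    from fails.hyps(2) have "E \<subseteq> trail_atoms (trail s)" by (auto simp: failure_reason_def)
    with fails show ?case by auto
  next
    case (blocked j c' c0 js)
    from blocked.hyps(3) have "c' - {j} \<subseteq> trail_atoms (trail s)"
      by (auto simp: blocks_def violated_def)
    with blocked show ?case by auto
  qed simp
  then show "c0 \<subseteq> c" "c0 \<subseteq> trail_atoms (trail s) \<Longrightarrow> c \<subseteq> trail_atoms (trail s)"
    "j \<in> set js \<Longrightarrow> (\<exists>E. failure_reason S d (trail_atoms (trail s)) p j E \<and> E \<subseteq> c) \<or>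
      (\<exists>c' \<in> learned s. c' - {j} \<subseteq> c)"
    by auto
qed

lemma try_each_Applied:
  assumes "try_each S d s p js c0 (Applied j T)"
  shows "infer S d j (current s) T \<and> (\<forall>c \<in> learned s. \<not> blocks (trail_atoms (trail s)) j c)"
  using assms by (induction js c0 "Applied j T" rule: try_each.induct) auto

lemma try_each_exists:
  assumes "\<And>j. \<not> applicable S d j (current s) \<Longrightarrow>
    \<exists>E. failure_reason S d (trail_atoms (trail s)) p j E"
  shows "\<exists>r. try_each S d s p js c r"
proof (induction js arbitrary: c)
  case Nil
  show ?case using try_each.exhausted by blast
next
  case (Cons j js)
  show ?case
  proof (cases "applicable S d j (current s)")
    case False
    then obtain E where E: "failure_reason S d (trail_atoms (trail s)) p j E" using assms by blast
    obtain r where "try_each S d s p js (c \<union> E) r" using Cons by blast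
    with False E show ?thesis by (blast intro: try_each.fails)
  next
    case True
    show ?thesis
    proof (cases "\<exists>c' \<in> learned s. blocks (trail_atoms (trail s)) j c'")
      case True
      then obtain c' where c': "c' \<in> learned s" "blocks (trail_atoms (trail s)) j c'" by blast
      obtain r where "try_each S d s p js (c \<union> (c' - {j})) r" using Cons by blast
      with \<open>applicable S d j (current s)\<close> c' show ?thesis by (blast intro: try_each.blocked)
    next
      case False
      obtain T where "infer S d j (current s) T" using True by (auto simp: applicable_def)
      with False show ?thesis by (blast intro: try_each.succeeds)
    qed
  qed
qed

text \<open>Popping ends at the latest with the empty trail, which violates only the empty
  constraint. The trail merely shrinks, so earlier constraints stay unviolated.\<close>

lemma backtrack_derived:
  assumes "backtrack c T tr = (T', tr')" "derived_trail S d T tr"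
  shows "derived_trail S d T' tr'" and "trail_atoms tr' \<subseteq> trail_atoms tr"
    and "c \<noteq> {} \<Longrightarrow> \<not> violated c (trail_atoms tr')"
proof -
  have "derived_trail S d T' tr' \<and> trail_atoms tr' \<subseteq> trail_atoms tr \<and>
    (c \<noteq> {} \<longrightarrow> \<not> violated c (trail_atoms tr'))"
    using assms
    by (induction c T tr rule: backtrack.induct)
      (auto simp: trail_atoms_def violated_def split: if_splits)
  then show "derived_trail S d T' tr'" "trail_atoms tr' \<subseteq> trail_atoms tr"
    "c \<noteq> {} \<Longrightarrow> \<not> violated c (trail_atoms tr')" by auto
qed

text \<open>Here \<open>J\<close> stands for the atom set of one fixed closed tableau. Of the
  conditions on learned constraints, the bound gives finiteness, non-violation by \<open>J\<close>
  rules out the empty constraint, and non-violation by the trail makes each new constraint differ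
  from the old ones.\<close>

definition search_invariant ::
  "('f, 'p, 'v) clause set \<Rightarrow> nat \<Rightarrow> ('f, 'p, 'v) atom set \<Rightarrow> ('f, 'p, 'v) state \<Rightarrow> bool" where
  "search_invariant S d J s \<longleftrightarrow> derived_trail S d (current s) (trail s) \<and>
     (\<forall>c \<in> learned s. c \<subseteq> atom_space S d \<and> \<not> violated c J \<and> \<not> violated c (trail_atoms (trail s)))"

lemma search_invariant_initial: "search_invariant S d J initial_state"
  by (simp add: search_invariant_def initial_state_def)

lemma learned_not_violated:
  assumes J: "represents S d J U" "is_closed U" and inv: "search_invariant S d J s"
    and p: "open_branch (current s) p"
    and js: "set js = possible_inferences S d (trail_atoms (trail s)) p"
    and stuck: "try_each S d s p js (path_inferences (trail_atoms (trail s)) p) (Stuck c)"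
  shows "\<not> violated c J"
proof
  assume c: "violated c J"
  let ?I = "trail_atoms (trail s)"
  have rep: "represents S d ?I (current s)"
    using inv derived_trail_represents(1) unfolding search_invariant_def by blast
  have fin: "finite ?I" by (simp add: trail_atoms_def)
  have D: "path_inferences ?I p \<subseteq> J"
    using try_each_Stuck(1)[OF stuck] c by (auto simp: violated_def)
  obtain j where j: "j \<in> J" "acts_at j = p"
    using closed_derivation_acts_at[OF rep p J D] by blast
  have "j \<in> set js"
    unfolding js using closed_derivation_possible[OF rep p fin J(1) D j] .
  from try_each_Stuck(3)[OF stuck this] show False
  proof (elim disjE exE bexE conjE)
    fix E assume "failure_reason S d ?I p j E" "E \<subseteq> c"
    then show False
      using failure_reason_not_in_derivation[OF rep p J(1) j D] c by (auto simp: violated_def)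
  next
    fix c' assume "c' \<in> learned s" "c' - {j} \<subseteq> c"
    then have "violated c' J" using c j(1) by (auto simp: violated_def)
    then show False using inv \<open>c' \<in> learned s\<close> by (simp add: search_invariant_def)
  qed
qed

text \<open>Each learned constraint is violated by the trail on which it was learned, whereas the earlier
  ones are not; so it is new.\<close>

lemma iteration_invariant:
  assumes fin: "finite S" and J: "represents S d J U" "is_closed U"
    and inv: "search_invariant S d J s" and it: "iteration S d s s'"
  shows "search_invariant S d J s'"
    and "(s', s) \<in> measures [\<lambda>s. card (Pow (atom_space S d) - learned s),
      \<lambda>s. card (atom_space S d) - length (trail s)]"
proof -
  let ?A = "atom_space S d"
  \<comment> \<open>The first component counts the constraints not yet learned, the second the room
    left on the trail. Applying an inference lowers the second; learning lowers the first, whatever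
    backtracking does to the trail.\<close>
  let ?M = "measures [\<lambda>s. card (Pow ?A - learned s), \<lambda>s. card ?A - length (trail s)]"
  have finA: "finite ?A" using fin by (rule finite_atom_space)
  have tr: "derived_trail S d (current s) (trail s)"
    and lrn: "\<And>c. c \<in> learned s \<Longrightarrow> c \<subseteq> ?A \<and> \<not> violated c J \<and> \<not> violated c (trail_atoms (trail s))"
    using inv by (auto simp: search_invariant_def)
  have "search_invariant S d J s' \<and> (s', s) \<in> ?M"
    using it
  proof cases
    case (apply_inference p I js j T')
    have j: "infer S d j (current s) T'" "\<And>c. c \<in> learned s \<Longrightarrow> \<not> blocks (trail_atoms (trail s)) j c"
      using try_each_Applied[OF apply_inference(7)] by auto
    have tr': "derived_trail S d T' ((j, current s) # trail s)" using j(1) tr by simp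
    have "\<not> violated c (insert j (trail_atoms (trail s)))" if "c \<in> learned s" for c
      using that j(2)[OF that] lrn[OF that] by (auto simp: blocks_def violated_def)
    then have "search_invariant S d J s'"
      using tr' lrn apply_inference(1) by (auto simp: search_invariant_def trail_atoms_def)
    \<comment> \<open>Subtraction on naturals is truncated, so the second component strictly
      decreases only because the longer trail still fits into the atom space; its atoms are
      distinct.\<close>
    moreover have "length ((j, current s) # trail s) \<le> card ?A"
    proof -
      have "length (map fst ((j, current s) # trail s)) = card (trail_atoms ((j, current s) # trail s))"
        using distinct_card[OF derived_trail_represents(2)[OF tr']] by (simp add: trail_atoms_def)
      also have "\<dots> \<le> card ?A"
        using represents_atom_space[OF derived_trail_represents(1)[OF tr']]
        by (rule card_mono[OF finA])
      finally show ?thesis by simp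
    qed
    ultimately show ?thesis using apply_inference(1) by auto
  next
    case (learn_constraint p I js c T' tr')
    have I: "represents S d (trail_atoms (trail s)) (current s)"
      using tr by (rule derived_trail_represents)
    have cJ: "\<not> violated c J"
      using learned_not_violated[OF J inv] learn_constraint by blast
    have cI: "c \<subseteq> trail_atoms (trail s)"
      using try_each_Stuck(2)[OF learn_constraint(7)] learn_constraint(4) path_inferences_subset by blast
    then have cA: "c \<subseteq> ?A" using represents_atom_space[OF I] by blast
    have "c \<noteq> {}" using cJ by (auto simp: violated_def)
    note bt = backtrack_derived[OF learn_constraint(8) tr]
    have "\<not> violated c' (trail_atoms tr')" if "c' \<in> insert c (learned s)" for c'
      using that lrn bt(2) bt(3)[OF \<open>c \<noteq> {}\<close>] by (auto simp: violated_def)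
    then have "search_invariant S d J s'"
      using bt(1) lrn cJ cA learn_constraint(1) by (simp add: search_invariant_def)
    moreover have "c \<notin> learned s" using lrn cI by (auto simp: violated_def)
    then have "card (Pow ?A - insert c (learned s)) < card (Pow ?A - learned s)"
      using cA finA by (intro psubset_card_mono) auto
    ultimately show ?thesis using learn_constraint(1) by simp
  qed
  then show "search_invariant S d J s'" "(s', s) \<in> ?M" by auto
qed

text \<open>The search cannot hang within an iteration: the possible inferences are finitely many
  and every inapplicable one has a failure reason. So a state without successor is a stopped
  one.\<close>

lemma iteration_exists:
  assumes fin: "finite S" and tr: "derived_trail S d (current s) (trail s)" and "\<not> stopped s"
  shows "\<exists>s'. iteration S d s s'"
proof -
  let ?I = "trail_atoms (trail s)"
  have rep: "represents S d ?I (current s)" using tr by (rule derived_trail_represents)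
  have "finite ?I" by (simp add: trail_atoms_def)
  obtain p where p: "open_branch (current s) p"
    using assms(3) by (auto simp: stopped_def is_closed_def)
  have "finite (possible_inferences S d ?I p)"
    using possible_inferences_atom_space finite_atom_space[OF fin] by (rule finite_subset)
  then obtain js where js: "distinct js" "set js = possible_inferences S d ?I p"
    using finite_distinct_list by metis
  obtain r where r: "try_each S d s p js (path_inferences ?I p) r"
    using try_each_exists failure_reason_exists[OF rep \<open>finite ?I\<close>] by metis
  show ?thesis
  proof (cases r)
    case (Applied j T')
    with r show ?thesis
      using iteration.apply_inference[OF assms(3) p refl js] by blast
  next
    case (Stuck c)
    obtain T' tr' where "backtrack c (current s) (trail s) = (T', tr')" by (rule prod.exhaust)
    with r Stuck show ?thesis
      using iteration.learn_constraint[OF assms(3) p refl js] by blast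
  qed
qed

theorem theorem1:
  fixes S :: "('f, 'p, 'v) clause set" and d :: nat
  assumes "finite S"
    and "\<exists>T. closed_tableau S d T"
  shows "(\<nexists>run. run 0 = (initial_state :: ('f, 'p, 'v) state) \<and>
                (\<forall>n. iteration S d (run n) (run (Suc n)))) \<and>
         (\<forall>s. (iteration S d)\<^sup>*\<^sup>* initial_state s \<and> (\<nexists>s'. iteration S d s s') \<longrightarrow>
              closed_tableau S d (current s) \<and> {} \<notin> learned s)"
proof -
  obtain U js where U: "infers S d js empty_tableau U" "is_closed U"
    using assms(2) by (auto simp: closed_tableau_def)
  let ?J = "set js"
  have J: "represents S d ?J U"
    using infers_represents(1)[OF represents_empty U(1)] by simp
  note step = iteration_invariant[OF assms(1) J U(2)]
  let ?M = "measures [\<lambda>s :: ('f, 'p, 'v) state. card (Pow (atom_space S d) - learned s),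
      \<lambda>s. card (atom_space S d) - length (trail s)]"
  show ?thesis
  proof (intro conjI notI allI impI)
    assume "\<exists>run. run 0 = (initial_state :: ('f, 'p, 'v) state) \<and>
      (\<forall>n. iteration S d (run n) (run (Suc n)))"
    then obtain run where run: "run 0 = (initial_state :: ('f, 'p, 'v) state)"
        "\<And>n. iteration S d (run n) (run (Suc n))" by blast
    have inv: "search_invariant S d ?J (run n)" for n
    proof (induction n)
      case 0
      show ?case unfolding run(1) by (rule search_invariant_initial)
    next
      case (Suc n)
      then show ?case using run(2) by (rule step(1))
    qed
    have "(run (Suc n), run n) \<in> ?M" for n using inv run(2) by (rule step(2))
    moreover have "wf ?M" by (rule wf_measures)
    ultimately show False unfolding wf_iff_no_infinite_down_chain by blast
  next
    fix s :: "('f, 'p, 'v) state"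
    assume s: "(iteration S d)\<^sup>*\<^sup>* initial_state s \<and> (\<nexists>s'. iteration S d s s')"
    then have "(iteration S d)\<^sup>*\<^sup>* initial_state s" by blast
    then have inv: "search_invariant S d ?J s"
      by (induction rule: rtranclp_induct) (auto intro: search_invariant_initial step(1))
    then have tr: "derived_trail S d (current s) (trail s)" by (simp add: search_invariant_def)
    have empty: "{} \<notin> learned s" using inv by (auto simp: search_invariant_def violated_def)
    have "stopped s" using iteration_exists[OF assms(1) tr] s by blast
    then have "is_closed (current s)" using empty by (simp add: stopped_def)
    then show "closed_tableau S d (current s)"
      using derived_trail_infers[OF tr] unfolding closed_tableau_def by blast
    show False if "{} \<in> learned s" using empty that by blast
  qed
qed

end
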